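(* Let $\{g(t,s)\}$ be the smooth $2$-parameter family of Riemannian metrics on a smooth $n$-manifold $M$ described in the context (a Ricci flow $g(t)=g(t,0)$ varied in $s$ through solutions of the modified Ricci flow with DeTurck term, with variation $h(t)=\frac{\partial}{\partial s}g(t,0)$), and let $\tilde g(t,s)$, $\tilde\nabla(t,s)$, $\tilde h$ be the associated space-time metric, space-time connection and space-time extension of $h$. Then at any point of $M\times[0,T)\times\{0\}$ (that is, at $s=0$), for all $0\le i,j,k\le n$, $$\frac{\partial}{\partial s}\tilde g^{ij}=-\tilde g^{ik}\tilde g^{jl}\tilde h_{kl}$$ and $$\frac{\partial}{\partial s}\tilde\Gamma^k_{ij}=\frac12\tilde g^{kl}\left(\tilde\nabla_i\tilde h_{jl}+\tilde\nabla_j\tilde h_{il}-\tilde\nabla_l\tilde h_{ij}\right).$$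
   Context: Setting. $g(t)$, $t\in[0,T)$, is a solution of the Ricci flow $\frac{\partial}{\partial t}g_{ij}=-2R_{ij}$ on $M$ with $g(0)=g_0$, and $h(t)$ is a symmetric $2$-tensor solving $\frac{\partial}{\partial t}h_{ij}=\Delta h_{ij}+2R_{pijq}h_{pq}-R_{iq}h_{jq}-R_{jq}h_{iq}$ with $h(0)=h_0$. The smooth $2$-parameter family of metrics $g(t,s)$, $t\in[0,T)$, $s$ near $0$, satisfies $$\frac{\partial}{\partial t}g_{ij}(t,s)=(-2R_{ij}+\nabla_iW_j+\nabla_jW_i)(t,s),\qquad W^k(t,s)=g^{ij}(t,s)\left(\Gamma_{ij}^k(t,s)-\Gamma_{ij}^k(t,0)\right),$$ with $g(0,0)=g_0$ and $\frac{\partial}{\partial s}g(0,0)=h_0$, where curvature, $\nabla$ and $\Gamma^k_{ij}(t,s)$ on the right are those of $g(t,s)$ and $W_j=g_{jk}W^k$. Moreover $g(t,0)=g(t)$ and $\frac{\partial}{\partial s}g_{ij}(t,0)=h_{ij}(t)$ for all $t\in[0,T)$. Curvature conventions: $R^l_{ijk}=\partial_i\Gamma^l_{jk}-\partial_j\Gamma^l_{ik}+\Gamma^p_{jk}\Gamma^l_{ip}-\Gamma^p_{ik}\Gamma^l_{jp}$, $R_{ijkl}=g_{lm}R^m_{ijk}$, $R_{jk}=R^p_{pjk}$; repeated lower indices are contracted with $g^{-1}$. Coordinates on $\tilde M=M\times[0,T)$ are $(x^0=t,x^1,\dots,x^n)$ with $x^1,\dots,x^n$ local coordinates on $M$. For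 each $s$, the degenerate space-time metric on $T^*\tilde M$ is $\tilde g^{ij}=g^{ij}$ if $i,j\ge1$ and $\tilde g^{ij}=0$ if $i=0$ or $j=0$ (with $g=g(t,s)$); the space-time connection $\tilde\nabla=\tilde\nabla(t,s)$ is the symmetric connection ($\tilde\Gamma_{ij}^k=\tilde\Gamma_{ji}^k$) with $\tilde\Gamma^k_{ij}=\Gamma^k_{ij}$ if $i,j,k\ge1$; $\tilde\Gamma^0_{ij}=0$ if $i,j\ge0$; $\tilde\Gamma^k_{i0}=-R^k_i+\nabla_iW^k$ if $i,k\ge1$; $\tilde\Gamma^k_{00}=-\frac12\nabla^k(R+|W|^2)+g^{kp}\frac{\partial}{\partial t}W_p$ if $k\ge1$, all with respect to $g(t,s)$. The space-time extension of $h$ (formed with $g(t)=g(t,0)$) is the symmetric $2$-tensor on $\tilde M$ with $\tilde h_{ij}=h_{ij}$ if $i,j\ge1$; $\tilde h_{0j}=\tilde h_{j0}=\mathrm{div}(h)_j=g^{pq}\nabla_ph_{qj}$ if $j\ge1$; $\tilde h_{00}=\mathrm{div}(\mathrm{div}(h))+Rc\cdot h$, where $\mathrm{div}(\mathrm{div}(h))=g^{jk}\nabla_j\mathrm{div}(h)_k$ and $Rc\cdot h=g^{ip}g^{jq}R_{ij}h_{pq}$. *)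

theory Defs
  imports "HOL-Analysis.Analysis"
begin

section \<open>Smooth functions\<close>

fun Ck_on :: "nat \<Rightarrow> 'a::euclidean_space set \<Rightarrow> ('a \<Rightarrow> 'b::real_normed_vector) \<Rightarrow> bool" where
  "Ck_on 0 S f \<longleftrightarrow> continuous_on S f"
| "Ck_on (Suc k) S f \<longleftrightarrow>
     (\<forall>x\<in>S. f differentiable (at x)) \<and>
     (\<forall>b\<in>Basis. Ck_on k S (\<lambda>x. frechet_derivative f (at x) b))"

text \<open>
  \<open>S\<close> need not be open (the time interval is half-open): a function is smooth on \<open>S\<close> if
  near every point of \<open>S\<close> it is the restriction of a smooth function on an open set.
\<close>

definition smooth_on :: "'a::euclidean_space set \<Rightarrow> ('a \<Rightarrow> 'b::real_normed_vector) \<Rightarrow> bool" where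
  "smooth_on S f \<longleftrightarrow>
     (\<forall>x\<in>S. \<exists>V F. open V \<and> x \<in> V \<and> (\<forall>k. Ck_on k V F) \<and> (\<forall>y\<in>V \<inter> S. F y = f y))"

definition pd :: "'n::finite \<Rightarrow> (real^'n \<Rightarrow> real) \<Rightarrow> real^'n \<Rightarrow> real" where
  "pd i f x = frechet_derivative f (at x) (axis i 1)"


section \<open>Smooth manifolds and covariant 2-tensor fields\<close>

text \<open>
  A chart is a pair of its domain and its coordinate map; the coordinate map is only
  meaningful on the domain. The atlas is not required to be maximal, so that the charts of a
  maximal atlas, i.e. all local coordinate systems, are covered as a special case.
\<close>

type_synonym ('m, 'n) chart = "'m set \<times> ('m \<Rightarrow> real^'n)"

definition coords :: "('m, 'n::finite) chart \<Rightarrow> (real^'n) set" where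
  "coords c = snd c ` fst c"

definition transition :: "('m, 'n::finite) chart \<Rightarrow> ('m, 'n) chart \<Rightarrow> real^'n \<Rightarrow> real^'n" where
  "transition c d = snd d \<circ> inv_into (fst c) (snd c)"

definition overlap :: "('m, 'n::finite) chart \<Rightarrow> ('m, 'n) chart \<Rightarrow> (real^'n) set" where
  "overlap c d = snd c ` (fst c \<inter> fst d)"

definition smooth_manifold :: "'m topology \<Rightarrow> ('m, 'n::finite) chart set \<Rightarrow> bool" where
  "smooth_manifold M A \<longleftrightarrow>
     Hausdorff_space M \<and> second_countable M \<and>
     (\<Union>c\<in>A. fst c) = topspace M \<and>
     (\<forall>c\<in>A. openin M (fst c) \<and> open (coords c) \<and>
        homeomorphic_map (subtopology M (fst c)) (top_of_set (coords c)) (snd c)) \<and>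
     (\<forall>c\<in>A. \<forall>d\<in>A. smooth_on (overlap c d) (transition c d))"

text \<open>
  A 2-tensor field assigns to every chart its matrix of components, as a function of the
  coordinates of that chart; only its values on \<open>coords c\<close> are meaningful.
\<close>

type_synonym ('m, 'n) tensor2 = "('m, 'n) chart \<Rightarrow> real^'n \<Rightarrow> real^'n^'n"

definition sym_tensor_field :: "('m, 'n::finite) chart set \<Rightarrow> ('m, 'n) tensor2 \<Rightarrow> bool" where
  "sym_tensor_field A T \<longleftrightarrow>
     (\<forall>c\<in>A. smooth_on (coords c) (T c) \<and> (\<forall>x\<in>coords c. transpose (T c x) = T c x)) \<and>
     (\<forall>c\<in>A. \<forall>d\<in>A. \<forall>x\<in>overlap c d. \<forall>i j.
        T c x $ i $ j =
          (\<Sum>k\<in>UNIV. \<Sum>l\<in>UNIV. pd i (\<lambda>y. transition c d y $ k) x * pd j (\<lambda>y. transition c d y $ l) x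
             * T d (transition c d x) $ k $ l))"

definition riemannian_metric :: "('m, 'n::finite) chart set \<Rightarrow> ('m, 'n) tensor2 \<Rightarrow> bool" where
  "riemannian_metric A g \<longleftrightarrow>
     sym_tensor_field A g \<and>
     (\<forall>c\<in>A. \<forall>x\<in>coords c. \<forall>v. v \<noteq> 0 \<longrightarrow> v \<bullet> (g c x *v v) > 0)"

definition tensor_eq :: "('m, 'n::finite) chart set \<Rightarrow> ('m, 'n) tensor2 \<Rightarrow> ('m, 'n) tensor2 \<Rightarrow> bool" where
  "tensor_eq A S T \<longleftrightarrow> (\<forall>c\<in>A. \<forall>x\<in>coords c. S c x = T c x)"


section \<open>Riemannian geometry in local coordinates\<close>

text \<open>
  In this section \<open>g\<close> and \<open>h\<close> are component matrices in a fixed chart. Upper indices precede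
  lower indices in argument lists, e.g. \<open>christoffel g k i j\<close> is $\Gamma^k_{ij}$.
\<close>

definition ginv :: "(real^'n::finite \<Rightarrow> real^'n^'n) \<Rightarrow> 'n \<Rightarrow> 'n \<Rightarrow> real^'n \<Rightarrow> real" where
  "ginv g i j x = matrix_inv (g x) $ i $ j"

definition comp2 :: "(real^'n::finite \<Rightarrow> real^'n^'n) \<Rightarrow> 'n \<Rightarrow> 'n \<Rightarrow> real^'n \<Rightarrow> real" where
  "comp2 h i j x = h x $ i $ j"

definition christoffel :: "(real^'n::finite \<Rightarrow> real^'n^'n) \<Rightarrow> 'n \<Rightarrow> 'n \<Rightarrow> 'n \<Rightarrow> real^'n \<Rightarrow> real" where
  "christoffel g k i j x =
     1/2 * (\<Sum>l\<in>UNIV. ginv g k l x *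
       (pd i (comp2 g j l) x + pd j (comp2 g i l) x - pd l (comp2 g i j) x))"

definition riem_up :: "(real^'n::finite \<Rightarrow> real^'n^'n) \<Rightarrow> 'n \<Rightarrow> 'n \<Rightarrow> 'n \<Rightarrow> 'n \<Rightarrow> real^'n \<Rightarrow> real" where
  "riem_up g l i j k x =
     pd i (christoffel g l j k) x - pd j (christoffel g l i k) x
     + (\<Sum>p\<in>UNIV. christoffel g p j k x * christoffel g l i p x)
     - (\<Sum>p\<in>UNIV. christoffel g p i k x * christoffel g l j p x)"

definition riem :: "(real^'n::finite \<Rightarrow> real^'n^'n) \<Rightarrow> 'n \<Rightarrow> 'n \<Rightarrow> 'n \<Rightarrow> 'n \<Rightarrow> real^'n \<Rightarrow> real" where
  "riem g i j k l x = (\<Sum>m\<in>UNIV. g x $ l $ m * riem_up g m i j k x)"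

definition ricci :: "(real^'n::finite \<Rightarrow> real^'n^'n) \<Rightarrow> 'n \<Rightarrow> 'n \<Rightarrow> real^'n \<Rightarrow> real" where
  "ricci g j k x = (\<Sum>p\<in>UNIV. riem_up g p p j k x)"

definition ricci_up :: "(real^'n::finite \<Rightarrow> real^'n^'n) \<Rightarrow> 'n \<Rightarrow> 'n \<Rightarrow> real^'n \<Rightarrow> real" where
  "ricci_up g k i x = (\<Sum>p\<in>UNIV. ginv g k p x * ricci g p i x)"

definition scal :: "(real^'n::finite \<Rightarrow> real^'n^'n) \<Rightarrow> real^'n \<Rightarrow> real" where
  "scal g x = (\<Sum>j\<in>UNIV. \<Sum>k\<in>UNIV. ginv g j k x * ricci g j k x)"

text \<open>Covariant derivatives; the first index is the direction of differentiation.\<close>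

definition cd_vec ::
  "(real^'n::finite \<Rightarrow> real^'n^'n) \<Rightarrow> ('n \<Rightarrow> real^'n \<Rightarrow> real) \<Rightarrow> 'n \<Rightarrow> 'n \<Rightarrow> real^'n \<Rightarrow> real" where
  "cd_vec g V i k x = pd i (V k) x + (\<Sum>p\<in>UNIV. christoffel g k i p x * V p x)"

definition cd_cov ::
  "(real^'n::finite \<Rightarrow> real^'n^'n) \<Rightarrow> ('n \<Rightarrow> real^'n \<Rightarrow> real) \<Rightarrow> 'n \<Rightarrow> 'n \<Rightarrow> real^'n \<Rightarrow> real" where
  "cd_cov g a i j x = pd i (a j) x - (\<Sum>p\<in>UNIV. christoffel g p i j x * a p x)"

definition cd_cov2 ::
  "(real^'n::finite \<Rightarrow> real^'n^'n) \<Rightarrow> ('n \<Rightarrow> 'n \<Rightarrow> real^'n \<Rightarrow> real) \<Rightarrow>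
     'n \<Rightarrow> 'n \<Rightarrow> 'n \<Rightarrow> real^'n \<Rightarrow> real" where
  "cd_cov2 g a i j k x =
     pd i (a j k) x
     - (\<Sum>p\<in>UNIV. christoffel g p i j x * a p k x)
     - (\<Sum>p\<in>UNIV. christoffel g p i k x * a j p x)"

definition cd_cov3 ::
  "(real^'n::finite \<Rightarrow> real^'n^'n) \<Rightarrow> ('n \<Rightarrow> 'n \<Rightarrow> 'n \<Rightarrow> real^'n \<Rightarrow> real) \<Rightarrow>
     'n \<Rightarrow> 'n \<Rightarrow> 'n \<Rightarrow> 'n \<Rightarrow> real^'n \<Rightarrow> real" where
  "cd_cov3 g a i j k l x =
     pd i (a j k l) x
     - (\<Sum>p\<in>UNIV. christoffel g p i j x * a p k l x)
     - (\<Sum>p\<in>UNIV. christoffel g p i k x * a j p l x)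
     - (\<Sum>p\<in>UNIV. christoffel g p i l x * a j k p x)"

definition rough_laplacian ::
  "(real^'n::finite \<Rightarrow> real^'n^'n) \<Rightarrow> ('n \<Rightarrow> 'n \<Rightarrow> real^'n \<Rightarrow> real) \<Rightarrow> 'n \<Rightarrow> 'n \<Rightarrow> real^'n \<Rightarrow> real" where
  "rough_laplacian g a i j x =
     (\<Sum>p\<in>UNIV. \<Sum>q\<in>UNIV. ginv g p q x * cd_cov3 g (cd_cov2 g a) p q i j x)"

definition grad :: "(real^'n::finite \<Rightarrow> real^'n^'n) \<Rightarrow> (real^'n \<Rightarrow> real) \<Rightarrow> 'n \<Rightarrow> real^'n \<Rightarrow> real" where
  "grad g f k x = (\<Sum>l\<in>UNIV. ginv g k l x * pd l f x)"

definition lower ::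
  "(real^'n::finite \<Rightarrow> real^'n^'n) \<Rightarrow> ('n \<Rightarrow> real^'n \<Rightarrow> real) \<Rightarrow> 'n \<Rightarrow> real^'n \<Rightarrow> real" where
  "lower g V j x = (\<Sum>k\<in>UNIV. g x $ j $ k * V k x)"

definition norm_sq ::
  "(real^'n::finite \<Rightarrow> real^'n^'n) \<Rightarrow> ('n \<Rightarrow> real^'n \<Rightarrow> real) \<Rightarrow> real^'n \<Rightarrow> real" where
  "norm_sq g V x = (\<Sum>i\<in>UNIV. \<Sum>j\<in>UNIV. g x $ i $ j * V i x * V j x)"

definition div2 ::
  "(real^'n::finite \<Rightarrow> real^'n^'n) \<Rightarrow> (real^'n \<Rightarrow> real^'n^'n) \<Rightarrow> 'n \<Rightarrow> real^'n \<Rightarrow> real" where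
  "div2 g h j x = (\<Sum>p\<in>UNIV. \<Sum>q\<in>UNIV. ginv g p q x * cd_cov2 g (comp2 h) p q j x)"

definition div1 ::
  "(real^'n::finite \<Rightarrow> real^'n^'n) \<Rightarrow> ('n \<Rightarrow> real^'n \<Rightarrow> real) \<Rightarrow> real^'n \<Rightarrow> real" where
  "div1 g a x = (\<Sum>j\<in>UNIV. \<Sum>k\<in>UNIV. ginv g j k x * cd_cov g a j k x)"

definition ricci_dot ::
  "(real^'n::finite \<Rightarrow> real^'n^'n) \<Rightarrow> (real^'n \<Rightarrow> real^'n^'n) \<Rightarrow> real^'n \<Rightarrow> real" where
  "ricci_dot g h x =
     (\<Sum>i\<in>UNIV. \<Sum>j\<in>UNIV. \<Sum>p\<in>UNIV. \<Sum>q\<in>UNIV.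
        ginv g i p x * ginv g j q x * ricci g i j x * h x $ p $ q)"


section \<open>The evolution equations\<close>

text \<open>\<open>T\<close> may be \<open>\<infinity>\<close>.\<close>

definition time_interval :: "ereal \<Rightarrow> real set" where
  "time_interval T = {t. 0 \<le> t \<and> ereal t < T}"

text \<open>
  All time derivatives are taken within \<open>I = time_interval T\<close>, hence are one-sided at
  \<open>t = 0\<close>.
\<close>

definition ricci_flow ::
  "('m, 'n::finite) chart set \<Rightarrow> real set \<Rightarrow> (real \<Rightarrow> ('m, 'n) tensor2) \<Rightarrow> bool" where
  "ricci_flow A I g \<longleftrightarrow>
     (\<forall>t\<in>I. riemannian_metric A (g t)) \<and>
     (\<forall>c\<in>A. smooth_on (I \<times> coords c) (\<lambda>(t, x). g t c x)) \<and>
     (\<forall>c\<in>A. \<forall>x\<in>coords c. \<forall>t\<in>I. \<forall>i j.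
        ((\<lambda>\<tau>. g \<tau> c x $ i $ j) has_real_derivative - 2 * ricci (g t c) i j x) (at t within I))"

definition lichnerowicz_heat_rhs ::
  "(real^'n::finite \<Rightarrow> real^'n^'n) \<Rightarrow> (real^'n \<Rightarrow> real^'n^'n) \<Rightarrow> 'n \<Rightarrow> 'n \<Rightarrow> real^'n \<Rightarrow> real" where
  "lichnerowicz_heat_rhs g h i j x =
     rough_laplacian g (comp2 h) i j x
     + 2 * (\<Sum>p\<in>UNIV. \<Sum>q\<in>UNIV. \<Sum>p'\<in>UNIV. \<Sum>q'\<in>UNIV.
              ginv g p p' x * ginv g q q' x * riem g p i j q x * h x $ p' $ q')
     - (\<Sum>q\<in>UNIV. \<Sum>q'\<in>UNIV. ginv g q q' x * ricci g i q x * h x $ j $ q')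
     - (\<Sum>q\<in>UNIV. \<Sum>q'\<in>UNIV. ginv g q q' x * ricci g j q x * h x $ i $ q')"

definition linearized_flow ::
  "('m, 'n::finite) chart set \<Rightarrow> real set \<Rightarrow> (real \<Rightarrow> ('m, 'n) tensor2) \<Rightarrow>
     (real \<Rightarrow> ('m, 'n) tensor2) \<Rightarrow> bool" where
  "linearized_flow A I g h \<longleftrightarrow>
     (\<forall>t\<in>I. sym_tensor_field A (h t)) \<and>
     (\<forall>c\<in>A. smooth_on (I \<times> coords c) (\<lambda>(t, x). h t c x)) \<and>
     (\<forall>c\<in>A. \<forall>x\<in>coords c. \<forall>t\<in>I. \<forall>i j.
        ((\<lambda>\<tau>. h \<tau> c x $ i $ j) has_real_derivative
           lichnerowicz_heat_rhs (g t c) (h t c) i j x) (at t within I))"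

text \<open>The field $W^k$ formed from the metrics \<open>g\<close> $= g(t,s)$ and \<open>g'\<close> $= g(t,0)$.\<close>

definition deturck ::
  "(real^'n::finite \<Rightarrow> real^'n^'n) \<Rightarrow> (real^'n \<Rightarrow> real^'n^'n) \<Rightarrow> 'n \<Rightarrow> real^'n \<Rightarrow> real" where
  "deturck g g' k x =
     (\<Sum>i\<in>UNIV. \<Sum>j\<in>UNIV. ginv g i j x * (christoffel g k i j x - christoffel g' k i j x))"

definition modified_ricci_flow_family ::
  "('m, 'n::finite) chart set \<Rightarrow> real set \<Rightarrow> real set \<Rightarrow> (real \<Rightarrow> real \<Rightarrow> ('m, 'n) tensor2) \<Rightarrow> bool" where
  "modified_ricci_flow_family A I J G \<longleftrightarrow>
     (\<forall>t\<in>I. \<forall>s\<in>J. riemannian_metric A (G t s)) \<and>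
     (\<forall>c\<in>A. smooth_on (I \<times> J \<times> coords c) (\<lambda>(t, s, x). G t s c x)) \<and>
     (\<forall>c\<in>A. \<forall>x\<in>coords c. \<forall>t\<in>I. \<forall>s\<in>J. \<forall>i j.
        ((\<lambda>\<tau>. G \<tau> s c x $ i $ j) has_real_derivative
           (let W = lower (G t s c) (deturck (G t s c) (G t 0 c)) in
            - 2 * ricci (G t s c) i j x + cd_cov (G t s c) W i j x + cd_cov (G t s c) W j i x))
          (at t within I))"


section \<open>Space-time objects\<close>

text \<open>
  Coordinates on \<open>M \<times> I\<close> are indexed by \<open>'n option\<close>: \<open>None\<close> is the time index 0,
  \<open>Some i\<close> is the spatial index \<open>i\<close>.
\<close>

definition td :: "real set \<Rightarrow> (real \<Rightarrow> real^'n::finite \<Rightarrow> real) \<Rightarrow> real \<Rightarrow> real^'n \<Rightarrow> real" where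
  "td I f t x = vector_derivative (\<lambda>\<tau>. f \<tau> x) (at t within I)"

fun st_pd ::
  "real set \<Rightarrow> 'n::finite option \<Rightarrow> (real \<Rightarrow> real^'n \<Rightarrow> real) \<Rightarrow> real \<Rightarrow> real^'n \<Rightarrow> real" where
  "st_pd I None f t x = td I f t x"
| "st_pd I (Some i) f t x = pd i (f t) x"

text \<open>The degenerate metric with upper indices, at a fixed time.\<close>

fun st_metric ::
  "(real^'n::finite \<Rightarrow> real^'n^'n) \<Rightarrow> 'n option \<Rightarrow> 'n option \<Rightarrow> real^'n \<Rightarrow> real" where
  "st_metric g (Some i) (Some j) x = ginv g i j x"
| "st_metric g None j x = 0"
| "st_metric g (Some i) None x = 0"

text \<open>
  Here \<open>g\<close> and \<open>g'\<close> are the time-dependent metrics $t \mapsto g(t,s)$ and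
  $t \mapsto g(t,0)$ in a fixed chart.
\<close>

fun st_christoffel ::
  "real set \<Rightarrow> (real \<Rightarrow> real^'n::finite \<Rightarrow> real^'n^'n) \<Rightarrow> (real \<Rightarrow> real^'n \<Rightarrow> real^'n^'n) \<Rightarrow>
     'n option \<Rightarrow> 'n option \<Rightarrow> 'n option \<Rightarrow> real \<Rightarrow> real^'n \<Rightarrow> real" where
  "st_christoffel I g g' None i j t x = 0"
| "st_christoffel I g g' (Some k) (Some i) (Some j) t x = christoffel (g t) k i j x"
| "st_christoffel I g g' (Some k) (Some i) None t x =
     - ricci_up (g t) k i x + cd_vec (g t) (deturck (g t) (g' t)) i k x"
| "st_christoffel I g g' (Some k) None (Some i) t x =
     - ricci_up (g t) k i x + cd_vec (g t) (deturck (g t) (g' t)) i k x"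
| "st_christoffel I g g' (Some k) None None t x =
     - 1/2 * grad (g t) (\<lambda>y. scal (g t) y + norm_sq (g t) (deturck (g t) (g' t)) y) k x
     + (\<Sum>p\<in>UNIV. ginv (g t) k p x *
          td I (\<lambda>\<tau>. lower (g \<tau>) (deturck (g \<tau>) (g' \<tau>)) p) t x)"

fun st_extension ::
  "(real^'n::finite \<Rightarrow> real^'n^'n) \<Rightarrow> (real^'n \<Rightarrow> real^'n^'n) \<Rightarrow>
     'n option \<Rightarrow> 'n option \<Rightarrow> real^'n \<Rightarrow> real" where
  "st_extension g h (Some i) (Some j) x = h x $ i $ j"
| "st_extension g h None (Some j) x = div2 g h j x"
| "st_extension g h (Some j) None x = div2 g h j x"
| "st_extension g h None None x = div1 g (div2 g h) x + ricci_dot g h x"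

text \<open>Covariant derivative of a space-time 2-tensor for a space-time connection \<open>\<Gamma>\<close>.\<close>

definition st_cd ::
  "real set \<Rightarrow>
     ('n::finite option \<Rightarrow> 'n option \<Rightarrow> 'n option \<Rightarrow> real \<Rightarrow> real^'n \<Rightarrow> real) \<Rightarrow>
     ('n option \<Rightarrow> 'n option \<Rightarrow> real \<Rightarrow> real^'n \<Rightarrow> real) \<Rightarrow>
     'n option \<Rightarrow> 'n option \<Rightarrow> 'n option \<Rightarrow> real \<Rightarrow> real^'n \<Rightarrow> real" where
  "st_cd I \<Gamma> a i j l t x =
     st_pd I i (a j l) t x
     - (\<Sum>p\<in>UNIV. \<Gamma> p i j t x * a p l t x)
     - (\<Sum>p\<in>UNIV. \<Gamma> p i l t x * a j p t x)"

end

theory Submission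
  imports Defs
begin

text \<open>
  At $s = 0$ the field $W$ vanishes and its $s$-derivative is
  $V_j = \mathrm{div}(h)_j - \frac12 \nabla_j \mathrm{tr}\, h$. Exchanging the $t$- and the
  $s$-derivative of $g(t,s)$ in the flow equation gives
  $\partial_t h_{ij} = -2\, \partial_s R_{ij} + \nabla_i V_j + \nabla_j V_i$, which expresses
  $\partial_s R_{ij}$ through $h$ without the linearization formula for the curvature; this settles
  the components $\tilde\Gamma^k_{i0}$. On the other hand
  $R_{jk} = R^p_{pjk}$ yields
  $g^{jk} \partial_s R_{jk} = \mathrm{div}\, V - \frac12 \Delta\, \mathrm{tr}\, h$, so that
  comparison of the two shows $g^{ij} \partial_t h_{ij} = \Delta\, \mathrm{tr}\, h$ and hence
  $\partial_s R + \partial_t \mathrm{tr}\, h = \mathrm{div}(\mathrm{div}(h)) + Rc \cdot h = \tilde h_{00}$.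
  The gradient of this identity is what the components $\tilde\Gamma^k_{00}$ require.
\<close>

section \<open>Calculus of smooth functions\<close>

text \<open>Two difficulties shape the proof. The time interval is half-open, so derivatives at t =
  0 are one-sided. All fields are therefore treated as smooth functions of (t, s, x) on a product
  set, differentiated along lines inside it, and mixed derivatives are exchanged through local
  smooth extensions. Moreover W vanishes only on the slice s = 0. An identity valid on the slice may
  be differentiated in t and x but not in s, so an s-derivative of a t- or x-derivative is always
  exchanged with it first.

  The splitting of V has two effects. Its gradient part has a symmetric Hessian and drops out of
  nabla_i V_l - nabla_l V_i, so that only div(h) is left in the variation of the mixed components;
  and the time derivative of that same part supplies the term that joins the s-derivative of R in
  the components with two time indices. Since W is of first order in s, its square norm contributes
  nothing.\<close>

lemma has_derivative_frechet:
  "f differentiable (at p) \<Longrightarrow> (f has_derivative frechet_derivative f (at p)) (at p)"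
  by (simp add: frechet_derivative_works)

lemma has_derivative_frechet_eq: "(f has_derivative f') (at p) \<Longrightarrow> frechet_derivative f (at p) = f'"
  by (metis frechet_derivative_at)

lemma has_real_derivative_along_line:
  fixes f :: "'a::real_normed_vector \<Rightarrow> real"
  assumes "(f has_derivative f') (at (p + u *\<^sub>R a))"
  shows "((\<lambda>v. f (p + v *\<^sub>R a)) has_real_derivative f' a) (at u)"
proof -
  have "((\<lambda>v. p + v *\<^sub>R a) has_derivative (\<lambda>v. v *\<^sub>R a)) (at u)"
    by (auto intro!: derivative_eq_intros)
  from has_derivative_compose[OF this assms]
  have "((\<lambda>v. f (p + v *\<^sub>R a)) has_derivative (\<lambda>v. f' (v *\<^sub>R a))) (at u)" .
  moreover have "(\<lambda>v. f' (v *\<^sub>R a)) = (*) (f' a)"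
    using has_derivative_linear[OF assms] by (auto simp: linear_cmul)
  ultimately show ?thesis by (simp add: has_field_derivative_def)
qed

text \<open>The second difference over a parallelogram is symmetric in \<open>a\<close> and
  \<open>b\<close>. The mean value theorem, applied in direction \<open>a\<close> to the difference
  across the edge \<open>u *\<^sub>R b\<close> and then in direction \<open>b\<close>, turns it into
  one mixed derivative at a point of the parallelogram.\<close>

lemma second_difference_eq:
  fixes f :: "'a::real_normed_vector \<Rightarrow> real"
  assumes f: "\<And>q. q \<in> V \<Longrightarrow> (f has_derivative f' q) (at q)"
    and f': "\<And>q. q \<in> V \<Longrightarrow> ((\<lambda>q. f' q a) has_derivative f'' q) (at q)"
    and V: "\<And>v w. 0 \<le> v \<Longrightarrow> v \<le> u \<Longrightarrow> 0 \<le> w \<Longrightarrow> w \<le> u \<Longrightarrow> p + v *\<^sub>R a + w *\<^sub>R b \<in> V"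
    and u: "0 < u"
  obtains v w where "0 < v" "v < u" "0 < w" "w < u"
    "f (p + u *\<^sub>R a + u *\<^sub>R b) - f (p + u *\<^sub>R a) - f (p + u *\<^sub>R b) + f p
      = u * (u * f'' (p + v *\<^sub>R a + w *\<^sub>R b) b)"
proof -
  define \<phi> where "\<phi> v = f (p + u *\<^sub>R b + v *\<^sub>R a) - f (p + v *\<^sub>R a)" for v
  have 1: "(\<phi> has_real_derivative f' (p + u *\<^sub>R b + v *\<^sub>R a) a - f' (p + v *\<^sub>R a) a) (at v)"
    if "0 \<le> v" "v \<le> u" for v
    unfolding \<phi>_def
    by (intro DERIV_diff has_real_derivative_along_line f)
      (use V[of v u] V[of v 0] that u in \<open>auto simp: algebra_simps\<close>)
  obtain v where v: "0 < v" "v < u" "\<phi> u - \<phi> 0 =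
      (u - 0) * (f' (p + u *\<^sub>R b + v *\<^sub>R a) a - f' (p + v *\<^sub>R a) a)"
    using MVT2[OF u 1] by auto
  have 2: "((\<lambda>w. f' (p + v *\<^sub>R a + w *\<^sub>R b) a) has_real_derivative
      f'' (p + v *\<^sub>R a + w *\<^sub>R b) b) (at w)" if "0 \<le> w" "w \<le> u" for w
    by (rule has_real_derivative_along_line) (use f' V[of v w] v that in auto)
  obtain w where w: "0 < w" "w < u" "f' (p + v *\<^sub>R a + u *\<^sub>R b) a - f' (p + v *\<^sub>R a + 0 *\<^sub>R b) a =
      (u - 0) * f'' (p + v *\<^sub>R a + w *\<^sub>R b) b"
    using MVT2[OF u 2] by auto
  show thesis
    by (rule that[of v w]) (use v w in \<open>auto simp: \<phi>_def algebra_simps\<close>)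
qed

text \<open>Schwarz's theorem. Both mixed derivatives, at suitable points of an arbitrarily small
  parallelogram, equal the same second difference divided by u^2; continuity at \<open>p\<close>
  forces them to agree.\<close>

lemma second_derivative_symmetric:
  fixes f :: "'a::real_normed_vector \<Rightarrow> real"
  assumes V: "open V" "p \<in> V"
    and f: "\<And>q. q \<in> V \<Longrightarrow> (f has_derivative f' q) (at q)"
    and fa: "\<And>q. q \<in> V \<Longrightarrow> ((\<lambda>q. f' q a) has_derivative fa q) (at q)"
    and fb: "\<And>q. q \<in> V \<Longrightarrow> ((\<lambda>q. f' q b) has_derivative fb q) (at q)"
    and cont: "continuous_on V (\<lambda>q. fa q b)" "continuous_on V (\<lambda>q. fb q a)"
  shows "fa p b = fb p a"
proof (rule ccontr)
  assume ne: "fa p b \<noteq> fb p a"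
  \<comment> \<open>Half the gap: no number lies at distance less than \<open>e\<close> from both
    values.\<close>
  define e where "e = \<bar>fa p b - fb p a\<bar> / 2"
  have e: "e > 0" using ne by (simp add: e_def)
  obtain d1 where d1: "d1 > 0" "\<And>q. q \<in> V \<Longrightarrow> dist q p < d1 \<Longrightarrow> dist (fa q b) (fa p b) < e"
    using cont(1) V(2) e unfolding continuous_on_iff by metis
  obtain d2 where d2: "d2 > 0" "\<And>q. q \<in> V \<Longrightarrow> dist q p < d2 \<Longrightarrow> dist (fb q a) (fb p a) < e"
    using cont(2) V(2) e unfolding continuous_on_iff by metis
  obtain d3 where d3: "d3 > 0" "ball p d3 \<subseteq> V"
    using V by (meson open_contains_ball)
  define d where "d = min d1 (min d2 d3)"
  \<comment> \<open>This keeps the whole parallelogram within d/2 of \<open>p\<close>; the summand 1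
    avoids a division by zero when both directions vanish.\<close>
  define u where "u = d / (2 * (norm a + norm b + 1))"
  have d: "d > 0" using d1 d2 d3 by (simp add: d_def)
  have np: "norm a + norm b + 1 > 0" by (simp add: add_nonneg_pos)
  have u: "u > 0" using d np by (simp add: u_def)
  have near: "dist (p + v *\<^sub>R a + w *\<^sub>R b) p < d" if "0 \<le> v" "v \<le> u" "0 \<le> w" "w \<le> u" for v w
  proof -
    have "dist (p + v *\<^sub>R a + w *\<^sub>R b) p = norm (v *\<^sub>R a + w *\<^sub>R b)"
      by (simp add: dist_norm algebra_simps)
    also have "\<dots> \<le> v * norm a + w * norm b"
      using norm_triangle_ineq[of "v *\<^sub>R a" "w *\<^sub>R b"] that by simp
    also have "\<dots> \<le> u * norm a + u * norm b"
      using that by (intro add_mono mult_right_mono) auto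
    also have "\<dots> \<le> u * (norm a + norm b + 1)" using u by (simp add: algebra_simps)
    also have "\<dots> = d / 2" using np unfolding u_def by (simp del: mult_2 distrib_left_numeral)
    also have "\<dots> < d" using d by simp
    finally show ?thesis .
  qed
  have inV: "p + v *\<^sub>R a + w *\<^sub>R b \<in> V" if "0 \<le> v" "v \<le> u" "0 \<le> w" "w \<le> u" for v w
    using near[OF that] d3 by (auto simp: d_def dist_commute)
  have inV': "p + v *\<^sub>R b + w *\<^sub>R a \<in> V" if "0 \<le> v" "v \<le> u" "0 \<le> w" "w \<le> u" for v w
    using inV[OF that(3,4,1,2)] by (simp add: algebra_simps)
  obtain v w where vw: "0 < v" "v < u" "0 < w" "w < u"
    "f (p + u *\<^sub>R a + u *\<^sub>R b) - f (p + u *\<^sub>R a) - f (p + u *\<^sub>R b) + f p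
      = u * (u * fa (p + v *\<^sub>R a + w *\<^sub>R b) b)"
    using second_difference_eq[OF f fa inV u] by blast
  obtain v' w' where vw': "0 < v'" "v' < u" "0 < w'" "w' < u"
    "f (p + u *\<^sub>R b + u *\<^sub>R a) - f (p + u *\<^sub>R b) - f (p + u *\<^sub>R a) + f p
      = u * (u * fb (p + v' *\<^sub>R b + w' *\<^sub>R a) a)"
    using second_difference_eq[OF f fb inV' u] by blast
  have "p + u *\<^sub>R b + u *\<^sub>R a = p + u *\<^sub>R a + u *\<^sub>R b" by simp
  with vw(5) vw'(5) have "u * (u * fa (p + v *\<^sub>R a + w *\<^sub>R b) b) = u * (u * fb (p + v' *\<^sub>R b + w' *\<^sub>R a) a)"
    by (simp only:)
  hence eq: "fa (p + v *\<^sub>R a + w *\<^sub>R b) b = fb (p + v' *\<^sub>R b + w' *\<^sub>R a) a" using u by simp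
  have "dist (fa (p + v *\<^sub>R a + w *\<^sub>R b) b) (fa p b) < e"
    using vw near[of v w] inV[of v w] by (intro d1) (auto simp: d_def)
  moreover have "dist (fb (p + v' *\<^sub>R b + w' *\<^sub>R a) a) (fb p a) < e"
    using vw' near[of w' v'] inV'[of v' w'] by (intro d2) (auto simp: d_def algebra_simps)
  ultimately show False using eq by (simp add: dist_real_def e_def) argo
qed

section \<open>Functions of class C^k on open sets\<close>

lemma Ck_on_subset: "Ck_on k S f \<Longrightarrow> T \<subseteq> S \<Longrightarrow> Ck_on k T f"
  by (induction k arbitrary: f) (auto intro: continuous_on_subset)

lemma Ck_on_Suc_imp: "Ck_on (Suc k) S f \<Longrightarrow> Ck_on k S f"
proof (induction k arbitrary: f)
  case 0
  then show ?case
    by (auto intro!: continuous_at_imp_continuous_on differentiable_imp_continuous_within)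
next
  case (Suc k)
  have "Ck_on k S (\<lambda>x. frechet_derivative f (at x) b)" if "b \<in> Basis" for b
    using Suc.prems that by (intro Suc.IH) simp
  thus ?case using Suc.prems by simp
qed

lemma Ck_on_continuous: "Ck_on k S f \<Longrightarrow> continuous_on S f"
  by (induction k) (auto dest: Ck_on_Suc_imp simp del: Ck_on.simps(2))

text \<open>\<open>frechet_derivative\<close> at a point depends on the values nearby; on an open
  set, agreement at all points gives agreement near each of them.\<close>

lemma Ck_on_cong:
  fixes f g :: "'a::euclidean_space \<Rightarrow> 'b::real_normed_vector"
  assumes "open S" and "\<And>x. x \<in> S \<Longrightarrow> f x = g x"
  shows "Ck_on k S f \<longleftrightarrow> Ck_on k S g"
proof -
  have *: "Ck_on k S g" if "Ck_on k S f" "\<And>x. x \<in> S \<Longrightarrow> f x = g x"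
    for f g :: "'a \<Rightarrow> 'b"
    using that
  proof (induction k arbitrary: f g)
    case 0
    then show ?case by (metis Ck_on.simps(1) continuous_on_eq)
  next
    case (Suc k)
    have g: "(g has_derivative frechet_derivative f (at x)) (at x)" if "x \<in> S" for x
      by (rule has_derivative_transform_within_open[OF has_derivative_frechet assms(1) that])
        (use Suc.prems that in auto)
    have "Ck_on k S (\<lambda>x. frechet_derivative g (at x) b)" if "b \<in> Basis" for b
      by (rule Suc.IH[of "\<lambda>x. frechet_derivative f (at x) b"])
        (use Suc.prems that has_derivative_frechet_eq[OF g] in auto)
    with g show ?case by (auto simp: differentiable_def)
  qed
  show ?thesis using *[of f g] *[of g f] assms(2) by auto
qed

text \<open>Lets the derivative be given by an explicit formula, as the product and chain rules
  produce it, instead of by \<open>frechet_derivative\<close>.\<close>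

lemma Ck_on_SucI:
  assumes S: "open S"
    and f: "\<And>x. x \<in> S \<Longrightarrow> (f has_derivative f' x) (at x)"
    and f': "\<And>b. b \<in> Basis \<Longrightarrow> Ck_on k S (\<lambda>x. f' x b)"
  shows "Ck_on (Suc k) S f"
proof -
  have "Ck_on k S (\<lambda>x. frechet_derivative f (at x) b)" if "b \<in> Basis" for b
    using f'[OF that] has_derivative_frechet_eq[OF f]
    by (subst Ck_on_cong[OF S, of _ "\<lambda>x. f' x b"]) auto
  with f show ?thesis by (auto simp: differentiable_def)
qed

lemma Ck_on_const: "Ck_on k S (\<lambda>x. c)"
  by (induction k arbitrary: c) auto

lemma Ck_on_add:
  assumes S: "open S"
  shows "Ck_on k S f \<Longrightarrow> Ck_on k S g \<Longrightarrow> Ck_on k S (\<lambda>x. f x + g x)"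
proof (induction k arbitrary: f g)
  case 0
  then show ?case by (auto intro: continuous_intros)
next
  case (Suc k)
  show ?case
    by (rule Ck_on_SucI[OF S has_derivative_add[OF has_derivative_frechet has_derivative_frechet]])
      (use Suc in auto)
qed

lemma Ck_on_mult:
  fixes f g :: "'a::euclidean_space \<Rightarrow> real"
  assumes S: "open S"
  shows "Ck_on k S f \<Longrightarrow> Ck_on k S g \<Longrightarrow> Ck_on k S (\<lambda>x. f x * g x)"
proof (induction k arbitrary: f g)
  case 0
  then show ?case by (auto intro: continuous_intros)
next
  case (Suc k)
  note * = Ck_on_Suc_imp[OF Suc.prems(1)] Ck_on_Suc_imp[OF Suc.prems(2)]
  show ?case
    by (rule Ck_on_SucI[OF S has_derivative_mult[OF has_derivative_frechet has_derivative_frechet]])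
      (use Suc * in \<open>auto intro!: Ck_on_add[OF S]\<close>)
qed

lemma Ck_on_inverse:
  fixes f :: "'a::euclidean_space \<Rightarrow> real"
  assumes S: "open S" and nz: "\<And>x. x \<in> S \<Longrightarrow> f x \<noteq> 0"
  shows "Ck_on k S f \<Longrightarrow> Ck_on k S (\<lambda>x. inverse (f x))"
proof (induction k)
  case 0
  then show ?case using nz by (auto intro!: continuous_intros)
next
  case (Suc k)
  note * = Suc.IH[OF Ck_on_Suc_imp[OF Suc.prems]]
  have d: "((\<lambda>x. inverse (f x)) has_derivative
      (\<lambda>v. - (inverse (f x) * frechet_derivative f (at x) v * inverse (f x)))) (at x)" if "x \<in> S" for x
    using Suc.prems nz that by (intro Deriv.has_derivative_inverse has_derivative_frechet) auto
  have m: "Ck_on k S (\<lambda>x. (-1) * (inverse (f x) * frechet_derivative f (at x) b * inverse (f x)))"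
    if "b \<in> Basis" for b
    by (intro Ck_on_mult[OF S] Ck_on_const *) (use Suc.prems that in auto)
  show ?case
    by (rule Ck_on_SucI[OF S d]) (use m in auto)
qed

lemma Ck_on_bounded_linear:
  assumes S: "open S" and L: "bounded_linear L"
  shows "Ck_on k S f \<Longrightarrow> Ck_on k S (\<lambda>x. L (f x))"
proof (induction k arbitrary: f)
  case 0
  then show ?case using L by (auto intro: bounded_linear.continuous_on)
next
  case (Suc k)
  show ?case
    by (rule Ck_on_SucI[OF S bounded_linear.has_derivative[OF L has_derivative_frechet]])
      (use Suc in auto)
qed

text \<open>\<open>Ck_on\<close> speaks of derivatives in basis directions only, so the chain rule
  closes up if \<open>L\<close> sends basis vectors to basis vectors or to 0. The intended
  \<open>L\<close> is the projection of (t, s, x) to (t, 0, x).\<close>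

lemma Ck_on_compose_linear:
  assumes S: "open S" and L: "bounded_linear L"
    and basis: "\<And>b. b \<in> Basis \<Longrightarrow> L b = 0 \<or> L b \<in> Basis"
  shows "Ck_on k S f \<Longrightarrow> Ck_on k (L -` S) (\<lambda>x. f (L x))"
proof (induction k arbitrary: f)
  case 0
  have "continuous_on (L -` S) L"
    using L by (simp add: linear_continuous_on)
  with 0 show ?case
    by (auto intro: continuous_on_compose2)
next
  case (Suc k)
  have V: "open (L -` S)"
    using L S by (simp add: continuous_open_vimage linear_continuous_at)
  have f: "(f has_derivative frechet_derivative f (at x)) (at x)" if "x \<in> S" for x
    using Suc.prems that by (auto intro: has_derivative_frechet)
  have d: "((\<lambda>x. f (L x)) has_derivative (\<lambda>v. frechet_derivative f (at (L x)) (L v))) (at x)"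
    if "x \<in> L -` S" for x
    by (rule has_derivative_compose[OF bounded_linear_imp_has_derivative[OF L] f]) (use that in auto)
  \<comment> \<open>Linearity of the derivative is known only where \<open>f\<close> is
    differentiable, hence the passage through a congruence on the preimage of
    \<open>S\<close>.\<close>
  have 0: "Ck_on k (L -` S) (\<lambda>x. frechet_derivative f (at (L x)) 0)"
  proof (subst Ck_on_cong[OF V])
    show "frechet_derivative f (at (L x)) 0 = 0" if "x \<in> L -` S" for x
      using has_derivative_linear[OF f] that by (simp add: linear_0)
    show "Ck_on k (L -` S) (\<lambda>x. 0)" by (rule Ck_on_const)
  qed
  have b: "Ck_on k (L -` S) (\<lambda>x. frechet_derivative f (at (L x)) (L b))" if "b \<in> Basis" for b
  proof (cases "L b = 0")
    case True
    then show ?thesis using 0 by simp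
  next
    case False
    hence "L b \<in> Basis" using basis that by blast
    thus ?thesis using Suc.prems by (intro Suc.IH) auto
  qed
  show ?case by (rule Ck_on_SucI[OF V d b])
qed

section \<open>Smoothness on sets that need not be open\<close>

lemma smooth_onE:
  assumes "smooth_on S f" "p \<in> S"
  obtains V F where "open V" "p \<in> V" "\<And>k. Ck_on k V F" "\<And>y. y \<in> V \<Longrightarrow> y \<in> S \<Longrightarrow> F y = f y"
  using assms unfolding smooth_on_def by (metis IntI)

lemma smooth_onI:
  assumes "\<And>p. p \<in> S \<Longrightarrow>
    \<exists>V F. open V \<and> p \<in> V \<and> (\<forall>k. Ck_on k V F) \<and> (\<forall>y\<in>V \<inter> S. F y = f y)"
  shows "smooth_on S f"
  using assms unfolding smooth_on_def by blast

lemma smooth_on_cong: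
  assumes "smooth_on S f" "\<And>x. x \<in> S \<Longrightarrow> f x = g x"
  shows "smooth_on S g"
  using assms unfolding smooth_on_def by (metis IntD2)

lemma smooth_on_const: "smooth_on S (\<lambda>x. c)"
  by (rule smooth_onI) (auto intro!: exI[of _ UNIV] exI[of _ "\<lambda>x. c"] Ck_on_const)

lemma smooth_on_add:
  assumes "smooth_on S f" "smooth_on S g"
  shows "smooth_on S (\<lambda>x. f x + g x)"
proof (rule smooth_onI)
  fix p assume p: "p \<in> S"
  obtain V F where F: "open V" "p \<in> V" "\<And>k. Ck_on k V F" "\<And>y. y \<in> V \<Longrightarrow> y \<in> S \<Longrightarrow> F y = f y"
    using smooth_onE[OF assms(1) p] by metis
  obtain W H where H: "open W" "p \<in> W" "\<And>k. Ck_on k W H" "\<And>y. y \<in> W \<Longrightarrow> y \<in> S \<Longrightarrow> H y = g y"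
    using smooth_onE[OF assms(2) p] by metis
  show "\<exists>V F. open V \<and> p \<in> V \<and> (\<forall>k. Ck_on k V F) \<and> (\<forall>y\<in>V \<inter> S. F y = f y + g y)"
    using F H
    by (auto intro!: exI[of _ "V \<inter> W"] exI[of _ "\<lambda>x. F x + H x"] Ck_on_add open_Int
        intro: Ck_on_subset)
qed

lemma smooth_on_mult:
  fixes f g :: "'a::euclidean_space \<Rightarrow> real"
  assumes "smooth_on S f" "smooth_on S g"
  shows "smooth_on S (\<lambda>x. f x * g x)"
proof (rule smooth_onI)
  fix p assume p: "p \<in> S"
  obtain V F where F: "open V" "p \<in> V" "\<And>k. Ck_on k V F" "\<And>y. y \<in> V \<Longrightarrow> y \<in> S \<Longrightarrow> F y = f y"
    using smooth_onE[OF assms(1) p] by metis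
  obtain W H where H: "open W" "p \<in> W" "\<And>k. Ck_on k W H" "\<And>y. y \<in> W \<Longrightarrow> y \<in> S \<Longrightarrow> H y = g y"
    using smooth_onE[OF assms(2) p] by metis
  show "\<exists>V F. open V \<and> p \<in> V \<and> (\<forall>k. Ck_on k V F) \<and> (\<forall>y\<in>V \<inter> S. F y = f y * g y)"
    using F H
    by (auto intro!: exI[of _ "V \<inter> W"] exI[of _ "\<lambda>x. F x * H x"] Ck_on_mult open_Int
        intro: Ck_on_subset)
qed

lemma smooth_on_minus:
  fixes f :: "'a::euclidean_space \<Rightarrow> real"
  shows "smooth_on S f \<Longrightarrow> smooth_on S (\<lambda>x. - f x)"
  using smooth_on_mult[OF smooth_on_const[of S "-1"], of f] by simp

lemma smooth_on_diff:
  fixes f g :: "'a::euclidean_space \<Rightarrow> real"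
  shows "smooth_on S f \<Longrightarrow> smooth_on S g \<Longrightarrow> smooth_on S (\<lambda>x. f x - g x)"
  using smooth_on_add[OF _ smooth_on_minus, of S f g] by simp

lemma smooth_on_divide_const:
  fixes f :: "'a::euclidean_space \<Rightarrow> real"
  shows "smooth_on S f \<Longrightarrow> smooth_on S (\<lambda>x. f x / c)"
  using smooth_on_mult[OF smooth_on_const[of S "inverse c"], of f] by (simp add: field_simps)

lemma smooth_on_sum:
  "(\<And>i. i \<in> A \<Longrightarrow> smooth_on S (f i)) \<Longrightarrow> smooth_on S (\<lambda>x. \<Sum>i\<in>A. f i x)"
  by (induction A rule: infinite_finite_induct) (auto intro: smooth_on_const smooth_on_add)

lemma smooth_on_prod:
  fixes f :: "'i \<Rightarrow> 'a::euclidean_space \<Rightarrow> real"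
  shows "(\<And>i. i \<in> A \<Longrightarrow> smooth_on S (f i)) \<Longrightarrow> smooth_on S (\<lambda>x. \<Prod>i\<in>A. f i x)"
  by (induction A rule: infinite_finite_induct) (auto intro: smooth_on_const smooth_on_mult)

lemma smooth_on_inverse:
  fixes f :: "'a::euclidean_space \<Rightarrow> real"
  assumes "smooth_on S f" "\<And>x. x \<in> S \<Longrightarrow> f x \<noteq> 0"
  shows "smooth_on S (\<lambda>x. inverse (f x))"
proof (rule smooth_onI)
  fix p assume p: "p \<in> S"
  obtain V F where F: "open V" "p \<in> V" "\<And>k. Ck_on k V F" "\<And>y. y \<in> V \<Longrightarrow> y \<in> S \<Longrightarrow> F y = f y"
    using smooth_onE[OF assms(1) p] by metis
  \<comment> \<open>The extension \<open>F\<close> may vanish at points outside \<open>S\<close>;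
    the neighbourhood is shrunk to where it does not.\<close>
  define W where "W = {x \<in> V. F x \<noteq> 0}"
  have "W = V \<inter> F -` (- {0})" by (auto simp: W_def)
  hence W: "open W"
    using continuous_open_preimage[OF Ck_on_continuous[OF F(3)[of 0]] F(1), of "- {0}"] by auto
  show "\<exists>V F. open V \<and> p \<in> V \<and> (\<forall>k. Ck_on k V F) \<and> (\<forall>y\<in>V \<inter> S. F y = inverse (f y))"
  proof (intro exI[of _ W] exI[of _ "\<lambda>x. inverse (F x)"] conjI allI)
    show "Ck_on k W (\<lambda>x. inverse (F x))" for k
      by (rule Ck_on_inverse[OF W _ Ck_on_subset[OF F(3)]]) (auto simp: W_def)
  qed (use F W assms(2)[OF p] p in \<open>auto simp: W_def\<close>)
qed

lemma smooth_on_bounded_linear: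
  assumes "smooth_on S f" "bounded_linear L"
  shows "smooth_on S (\<lambda>x. L (f x))"
  using assms(1) unfolding smooth_on_def by (metis Ck_on_bounded_linear[OF _ assms(2)])

lemma smooth_on_compose_linear:
  assumes f: "smooth_on S f" and L: "bounded_linear L" "\<And>b. b \<in> Basis \<Longrightarrow> L b = 0 \<or> L b \<in> Basis"
    and T: "L ` T \<subseteq> S"
  shows "smooth_on T (\<lambda>x. f (L x))"
proof (rule smooth_onI)
  fix p assume p: "p \<in> T"
  obtain V F where F: "open V" "L p \<in> V" "\<And>k. Ck_on k V F" "\<And>y. y \<in> V \<Longrightarrow> y \<in> S \<Longrightarrow> F y = f y"
    using smooth_onE[OF f, of "L p"] T p by blast
  have "open (L -` V)"
    using L F by (simp add: continuous_open_vimage linear_continuous_at)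
  thus "\<exists>V F. open V \<and> p \<in> V \<and> (\<forall>k. Ck_on k V F) \<and> (\<forall>y\<in>V \<inter> T. F y = f (L y))"
  proof (intro exI[of _ "L -` V"] exI[of _ "\<lambda>x. F (L x)"] conjI allI)
    show "Ck_on k (L -` V) (\<lambda>x. F (L x))" for k
      by (rule Ck_on_compose_linear[OF F(1) L F(3)])
  qed (use F T in auto)
qed

lemma smooth_on_det:
  fixes f :: "'i::finite \<Rightarrow> 'i \<Rightarrow> 'a::euclidean_space \<Rightarrow> real"
  assumes "\<And>i j. smooth_on S (f i j)"
  shows "smooth_on S (\<lambda>x. det (\<chi> i j. f i j x))"
  unfolding det_def vec_lambda_beta
  by (intro smooth_on_sum smooth_on_mult smooth_on_const smooth_on_prod assms)

section \<open>Smooth dependence of the inverse matrix\<close>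

lemma matrix_inv_inverse:
  fixes A :: "real^'n^'n"
  assumes "invertible A"
  shows "A ** matrix_inv A = mat 1" "matrix_inv A ** A = mat 1"
  using someI_ex[of "\<lambda>B. A ** B = mat 1 \<and> B ** A = mat 1"] assms
  by (auto simp: invertible_def matrix_inv_def)

text \<open>Cramer's rule for A v = e_j, whose solution is column j of the inverse. It presents the
  entries of the inverse through determinants, to which the sum and product rules for smooth
  functions apply.\<close>

lemma matrix_inv_cramer:
  fixes A :: "real^'n^'n"
  assumes "invertible A"
  shows "matrix_inv A $ k $ j = det (\<chi> i l. if l = k then of_bool (i = j) else A $ i $ l) * inverse (det A)"
proof -
  have d: "det A \<noteq> 0" using assms by (simp add: invertible_det_nz)
  have "A *v (matrix_inv A *v axis j 1) = axis j 1"
    using assms by (simp add: matrix_vector_mul_assoc matrix_inv_inverse)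
  hence "matrix_inv A *v axis j 1 =
      (\<chi> k. det (\<chi> i l. if l = k then axis j 1 $ i else A $ i $ l) / det A)"
    using cramer[OF d] by blast
  hence "(matrix_inv A *v axis j 1) $ k = det (\<chi> i l. if l = k then axis j 1 $ i else A $ i $ l) / det A"
    by simp
  moreover have "(matrix_inv A *v axis j 1) $ k = matrix_inv A $ k $ j"
    by (simp add: matrix_vector_mult_basis column_def)
  moreover have "axis j 1 $ i = (of_bool (i = j) :: real)" for i
    by (simp add: axis_def)
  ultimately show ?thesis by (simp only: divide_inverse)
qed

lemma smooth_on_matrix_inv:
  fixes m :: "'a::euclidean_space \<Rightarrow> real^'n^'n"
  assumes m: "\<And>i j. smooth_on S (\<lambda>x. m x $ i $ j)" and inv: "\<And>x. x \<in> S \<Longrightarrow> invertible (m x)"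
  shows "smooth_on S (\<lambda>x. matrix_inv (m x) $ k $ j)"
proof (rule smooth_on_cong)
  have "smooth_on S (\<lambda>x. if l = k then of_bool (i = j) else m x $ i $ l)" for i l
    by (cases "l = k") (auto intro: m smooth_on_const)
  moreover have "smooth_on S (\<lambda>x. det (m x))"
    using smooth_on_det[of S "\<lambda>i j x. m x $ i $ j"] m by (simp only: vec_lambda_eta)
  ultimately show "smooth_on S (\<lambda>x. det (\<chi> i l. if l = k then of_bool (i = j) else m x $ i $ l)
      * inverse (det (m x)))"
    using inv by (intro smooth_on_mult smooth_on_inverse smooth_on_det) (auto simp: invertible_det_nz)
qed (simp add: matrix_inv_cramer[OF inv])

section \<open>Directional derivatives inside a set\<close>

text \<open>
  The derivative only uses points of \<open>S\<close>; so it is the one-sided time derivative at the initial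
  time.
\<close>

definition dd :: "'a::real_normed_vector set \<Rightarrow> 'a \<Rightarrow> ('a \<Rightarrow> real) \<Rightarrow> 'a \<Rightarrow> real" where
  "dd S b f p = vector_derivative (\<lambda>u. f (p + u *\<^sub>R b)) (at 0 within {u. p + u *\<^sub>R b \<in> S})"

text \<open>Only values on the line through \<open>p\<close> matter. This later permits
  differentiating identities that hold merely on the slice s = 0.\<close>

lemma dd_cong_line:
  assumes "p \<in> S" "\<And>u. p + u *\<^sub>R b \<in> S \<Longrightarrow> f (p + u *\<^sub>R b) = g (p + u *\<^sub>R b)"
  shows "dd S b f p = dd S b g p"
proof -
  let ?L = "{u. p + u *\<^sub>R b \<in> S}"
  have "((\<lambda>u. f (p + u *\<^sub>R b)) has_vector_derivative D) (at 0 within ?L) \<longleftrightarrow>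
      ((\<lambda>u. g (p + u *\<^sub>R b)) has_vector_derivative D) (at 0 within ?L)" for D
    using assms by (auto intro: has_vector_derivative_transform[rotated 2])
  thus ?thesis by (simp add: dd_def vector_derivative_def)
qed

lemma dd_cong: "p \<in> S \<Longrightarrow> (\<And>q. q \<in> S \<Longrightarrow> f q = g q) \<Longrightarrow> dd S b f p = dd S b g p"
  by (rule dd_cong_line) auto

text \<open>A derivative within a set is determined only at a limit point of that set; the condition
  provides this on every coordinate line.\<close>

locale accessible_set =
  fixes S :: "'a::euclidean_space set"
  assumes accessible: "p \<in> S \<Longrightarrow> b \<in> Basis \<Longrightarrow> 0 islimpt {u. p + u *\<^sub>R b \<in> S}"
begin

lemma dd_unique:
  assumes "p \<in> S" "b \<in> Basis"
    and "((\<lambda>u. f (p + u *\<^sub>R b)) has_real_derivative D) (at 0 within {u. p + u *\<^sub>R b \<in> S})"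
  shows "dd S b f p = D"
  using assms accessible[OF assms(1,2)] unfolding dd_def
  by (intro vector_derivative_within)
    (auto simp: has_real_derivative_iff_has_vector_derivative trivial_limit_within)

text \<open>Near \<open>p\<close>, on the part of the line inside \<open>S\<close>, the function
  coincides with its extension, so it inherits the derivative, whichever extension was
  chosen.\<close>

lemma has_real_derivative_extension:
  assumes "open V" "p \<in> V" "p \<in> S" "F differentiable (at p)" "\<And>y. y \<in> V \<Longrightarrow> y \<in> S \<Longrightarrow> F y = f y"
  shows "((\<lambda>u. f (p + u *\<^sub>R b)) has_real_derivative frechet_derivative F (at p) b)
    (at 0 within {u. p + u *\<^sub>R b \<in> S})"
proof -
  have "open ((\<lambda>u. p + u *\<^sub>R b) -` V)"
    by (intro open_vimage assms(1) continuous_intros)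
  then obtain d where d: "d > 0" "ball 0 d \<subseteq> (\<lambda>u. p + u *\<^sub>R b) -` V"
    using assms(2) by (elim openE[of _ 0]) auto
  have "((\<lambda>u. F (p + u *\<^sub>R b)) has_real_derivative frechet_derivative F (at p) b) (at 0)"
    using has_real_derivative_along_line[of F _ p 0 b] has_derivative_frechet[OF assms(4)] by simp
  hence "((\<lambda>u. F (p + u *\<^sub>R b)) has_real_derivative frechet_derivative F (at p) b)
      (at 0 within {u. p + u *\<^sub>R b \<in> S})"
    by (rule has_field_derivative_at_within)
  thus ?thesis
    by (rule has_field_derivative_transform_within[OF _ d(1)])
      (use assms d(2) in \<open>auto simp: subset_iff dist_commute\<close>)
qed

lemma dd_extension:
  assumes "open V" "p \<in> V" "p \<in> S" "b \<in> Basis" "F differentiable (at p)"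
    "\<And>y. y \<in> V \<Longrightarrow> y \<in> S \<Longrightarrow> F y = f y"
  shows "dd S b f p = frechet_derivative F (at p) b"
  by (rule dd_unique[OF assms(3,4) has_real_derivative_extension[OF assms(1-3,5,6)]])

lemma has_real_derivative_dd:
  assumes "smooth_on S f" "p \<in> S" "b \<in> Basis"
  shows "((\<lambda>u. f (p + u *\<^sub>R b)) has_real_derivative dd S b f p) (at 0 within {u. p + u *\<^sub>R b \<in> S})"
proof -
  obtain V F where F: "open V" "p \<in> V" "\<And>k. Ck_on k V F" "\<And>y. y \<in> V \<Longrightarrow> y \<in> S \<Longrightarrow> F y = f y"
    using smooth_onE[OF assms(1,2)] by metis
  have "F differentiable (at p)" using F(3)[of "Suc 0"] F(2) by simp
  from has_real_derivative_extension[OF F(1,2) assms(2) this F(4)]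
    dd_extension[OF F(1,2) assms(2,3) this F(4)]
  show ?thesis by metis
qed

lemma has_real_derivative_dd_curve:
  assumes f: "smooth_on S f" "p \<in> S" "b \<in> Basis" and K: "\<And>u. u \<in> K \<Longrightarrow> p + (u - u0) *\<^sub>R b \<in> S"
  shows "((\<lambda>u. f (p + (u - u0) *\<^sub>R b)) has_real_derivative dd S b f p) (at u0 within K)"
proof -
  let ?g = "\<lambda>u. u - u0"
  have "((\<lambda>u. f (p + u *\<^sub>R b)) has_real_derivative dd S b f p) (at (?g u0) within ?g ` K)"
    using has_field_derivative_subset[OF has_real_derivative_dd[OF f], of "?g ` K"] K by auto
  moreover have "(?g has_real_derivative 1) (at u0 within K)"
    by (auto intro!: derivative_eq_intros)
  ultimately have "((\<lambda>u. f (p + u *\<^sub>R b)) \<circ> ?g has_real_derivative dd S b f p * 1) (at u0 within K)"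
    by (rule DERIV_image_chain)
  thus ?thesis by (simp add: o_def)
qed

text \<open>The directional derivative of a local extension is a local extension of
  \<open>dd S b f\<close>. Hence all iterated derivatives stay smooth, including the one-sided
  ones.\<close>

lemma smooth_on_dd:
  assumes "smooth_on S f" "b \<in> Basis"
  shows "smooth_on S (dd S b f)"
proof (rule smooth_onI)
  fix p assume p: "p \<in> S"
  obtain V F where F: "open V" "p \<in> V" "\<And>k. Ck_on k V F" "\<And>y. y \<in> V \<Longrightarrow> y \<in> S \<Longrightarrow> F y = f y"
    using smooth_onE[OF assms(1) p] by metis
  have diff: "F differentiable (at y)" if "y \<in> V" for y using F(3)[of "Suc 0"] that by simp
  show "\<exists>V F. open V \<and> p \<in> V \<and> (\<forall>k. Ck_on k V F) \<and> (\<forall>y\<in>V \<inter> S. F y = dd S b f y)"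
  proof (intro exI[of _ V] exI[of _ "\<lambda>y. frechet_derivative F (at y) b"] conjI allI ballI)
    show "Ck_on k V (\<lambda>y. frechet_derivative F (at y) b)" for k
      using F(3)[of "Suc k"] assms(2) by simp
    show "frechet_derivative F (at y) b = dd S b f y" if "y \<in> V \<inter> S" for y
      using dd_extension[OF F(1) _ _ assms(2) diff F(4), of y] that by simp
  qed (use F in auto)
qed

text \<open>Both iterated derivatives are read off from one local extension on an open set, where
  Schwarz's theorem applies. So t-derivatives may be exchanged with s- and x-derivatives even at t =
  0.\<close>

lemma dd_commute:
  assumes f: "smooth_on S f" and ab: "a \<in> Basis" "b \<in> Basis" and p: "p \<in> S"
  shows "dd S a (dd S b f) p = dd S b (dd S a f) p"
proof -
  obtain V F where F: "open V" "p \<in> V" "\<And>k. Ck_on k V F" "\<And>y. y \<in> V \<Longrightarrow> y \<in> S \<Longrightarrow> F y = f y"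
    using smooth_onE[OF f p] by metis
  have C2: "Ck_on (Suc (Suc 0)) V F" using F(3) .
  have diff: "F differentiable (at y)" if "y \<in> V" for y using C2 that by simp
  have diff2: "(\<lambda>q. frechet_derivative F (at q) c) differentiable (at y)"
    if "y \<in> V" "c \<in> Basis" for y c using C2 that by simp
  have cont: "continuous_on V (\<lambda>q. frechet_derivative (\<lambda>q. frechet_derivative F (at q) c) (at q) d)"
    if "c \<in> Basis" "d \<in> Basis" for c d
    using C2 that by simp
  have dF: "frechet_derivative F (at y) c = dd S c f y" if "y \<in> V" "y \<in> S" "c \<in> Basis" for y c
    using dd_extension[OF F(1) that diff[OF that(1)] F(4)] by simp
  have "dd S c (dd S d f) p = frechet_derivative (\<lambda>q. frechet_derivative F (at q) d) (at p) c"
    if "c \<in> Basis" "d \<in> Basis" for c d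
    using dd_extension[OF F(1,2) p that(1) diff2[OF F(2) that(2)] dF[OF _ _ that(2)]] by simp
  moreover have "frechet_derivative (\<lambda>q. frechet_derivative F (at q) a) (at p) b
      = frechet_derivative (\<lambda>q. frechet_derivative F (at q) b) (at p) a"
    by (rule second_derivative_symmetric[OF F(1,2) has_derivative_frechet[OF diff]
          has_derivative_frechet[OF diff2] has_derivative_frechet[OF diff2] cont cont])
      (use ab in auto)
  ultimately show ?thesis using ab by simp
qed

lemma dd_const: "p \<in> S \<Longrightarrow> b \<in> Basis \<Longrightarrow> dd S b (\<lambda>x. c) p = 0"
  by (rule dd_unique) auto

lemma dd_add:
  assumes "smooth_on S f" "smooth_on S g" "b \<in> Basis" "p \<in> S"
  shows "dd S b (\<lambda>x. f x + g x) p = dd S b f p + dd S b g p"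
  by (intro dd_unique DERIV_add has_real_derivative_dd assms)

lemma dd_diff:
  assumes "smooth_on S f" "smooth_on S g" "b \<in> Basis" "p \<in> S"
  shows "dd S b (\<lambda>x. f x - g x) p = dd S b f p - dd S b g p"
  by (intro dd_unique DERIV_diff has_real_derivative_dd assms)

lemma dd_minus:
  assumes "smooth_on S f" "b \<in> Basis" "p \<in> S"
  shows "dd S b (\<lambda>x. - f x) p = - dd S b f p"
  by (intro dd_unique DERIV_minus has_real_derivative_dd assms)

lemma dd_mult:
  assumes "smooth_on S f" "smooth_on S g" "b \<in> Basis" "p \<in> S"
  shows "dd S b (\<lambda>x. f x * g x) p = dd S b f p * g p + f p * dd S b g p"
  using DERIV_mult[OF has_real_derivative_dd[OF assms(1,4,3)] has_real_derivative_dd[OF assms(2,4,3)]]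
  by (intro dd_unique assms) (simp add: algebra_simps)

lemma dd_cmult:
  assumes "smooth_on S f" "b \<in> Basis" "p \<in> S"
  shows "dd S b (\<lambda>x. c * f x) p = c * dd S b f p"
  using dd_mult[OF smooth_on_const assms] dd_const[OF assms(3,2)] by simp

lemma dd_divide:
  assumes "smooth_on S f" "b \<in> Basis" "p \<in> S"
  shows "dd S b (\<lambda>x. f x / c) p = dd S b f p / c"
  using dd_cmult[OF assms, of "inverse c"] by (simp add: field_simps)

lemma dd_sum:
  assumes "\<And>i. i \<in> A \<Longrightarrow> smooth_on S (f i)" "b \<in> Basis" "p \<in> S"
  shows "dd S b (\<lambda>x. \<Sum>i\<in>A. f i x) p = (\<Sum>i\<in>A. dd S b (f i) p)"
  by (intro dd_unique DERIV_sum has_real_derivative_dd assms)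

end

section \<open>A two-parameter family of metrics in a chart\<close>

text \<open>The flow read in one chart. Times form a set without isolated points, which gives
  one-sided derivatives a meaning; positive definiteness of the metrics enters as invertibility of
  the component matrices.\<close>

locale metric_family =
  fixes I J :: "real set" and U :: "(real^'n::finite) set"
    and G :: "real \<Rightarrow> real \<Rightarrow> real^'n \<Rightarrow> real^'n^'n"
  assumes islimpt_I: "t \<in> I \<Longrightarrow> t islimpt I"
    and open_J: "open J" and zero_J: "0 \<in> J" and open_U: "open U"
    and smooth_G: "smooth_on (I \<times> J \<times> U) (\<lambda>(t, s, x). G t s x)"
    and sym_G: "t \<in> I \<Longrightarrow> s \<in> J \<Longrightarrow> x \<in> U \<Longrightarrow> transpose (G t s x) = G t s x"
    and invertible_G: "t \<in> I \<Longrightarrow> s \<in> J \<Longrightarrow> x \<in> U \<Longrightarrow> invertible (G t s x)"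
    and flow_G: "t \<in> I \<Longrightarrow> s \<in> J \<Longrightarrow> x \<in> U \<Longrightarrow>
      ((\<lambda>\<tau>. G \<tau> s x $ i $ j) has_real_derivative
         (let W = lower (G t s) (deturck (G t s) (G t 0)) in
          - 2 * ricci (G t s) i j x + cd_cov (G t s) W i j x + cd_cov (G t s) W j i x))
        (at t within I)"
begin

abbreviation "S \<equiv> I \<times> J \<times> U"
abbreviation "dt \<equiv> dd S (1, 0, 0)"
abbreviation "ds \<equiv> dd S (0, 1, 0)"
abbreviation "dx i \<equiv> dd S (0, 0, axis i 1)"

lemma Basis_directions [simp]:
  "(1, 0, 0) \<in> (Basis :: (real \<times> real \<times> (real^'n)) set)"
  "(0, 1, 0) \<in> (Basis :: (real \<times> real \<times> (real^'n)) set)"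
  "(0, 0, axis i 1) \<in> (Basis :: (real \<times> real \<times> (real^'n)) set)"
  by (auto simp: Basis_prod_def axis_in_Basis_iff zero_prod_def image_iff)

text \<open>A basis direction is either the t-direction, where limit points of \<open>I\<close> are
  used, or it lies in the open factor \<open>J \<times> U\<close>, where a whole interval of
  parameters is available.\<close>

sublocale accessible_set S
proof
  have op: "0 islimpt {u. a + u *\<^sub>R b \<in> X}" if "open X" "a \<in> X" for a b :: "'b::real_normed_vector" and X
  proof -
    have "open ((\<lambda>u. a + u *\<^sub>R b) -` X)"
      by (intro open_vimage that(1) continuous_intros)
    moreover have "(\<lambda>u. a + u *\<^sub>R b) -` X = {u. a + u *\<^sub>R b \<in> X}" by auto
    ultimately show ?thesis
      using that(2) by (intro interior_limit_point) (auto simp: interior_open)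
  qed
  fix p :: "real \<times> real \<times> (real^'n)" and b :: "real \<times> real \<times> (real^'n)"
  assume p: "p \<in> S" and b: "b \<in> Basis"
  obtain t s x where pt: "p = (t, s, x)" "t \<in> I" "s \<in> J" "x \<in> U" using p by auto
  from b consider "b = (1, 0, 0)" | y where "b = (0, y)"
    by (auto simp: Basis_prod_def zero_prod_def)
  then show "0 islimpt {u. p + u *\<^sub>R b \<in> S}"
  proof cases
    case 1
    have "{u. p + u *\<^sub>R b \<in> S} = (\<lambda>\<tau>. - t + \<tau>) ` I"
    proof (intro set_eqI iffI)
      fix u assume "u \<in> {u. p + u *\<^sub>R b \<in> S}"
      hence "t + u \<in> I" using 1 pt by auto
      thus "u \<in> (\<lambda>\<tau>. - t + \<tau>) ` I" by (intro image_eqI[of _ _ "t + u"]) auto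
    qed (use 1 pt in auto)
    moreover have "(- t + t) islimpt (\<lambda>\<tau>. - t + \<tau>) ` I"
      by (rule islimpt_isCont_image[OF islimpt_I[OF pt(2)]])
        (auto intro!: continuous_intros simp: eventually_at_filter)
    ultimately show ?thesis by simp
  next
    case 2
    have "open (J \<times> U)" using open_J open_U by (rule open_Times)
    hence "0 islimpt {u. (s, x) + u *\<^sub>R y \<in> J \<times> U}" by (rule op) (use pt in auto)
    moreover have "{u. (s, x) + u *\<^sub>R y \<in> J \<times> U} = {u. p + u *\<^sub>R b \<in> S}"
      using 2 pt by auto
    ultimately show ?thesis by simp
  qed
qed

text \<open>Because \<open>U\<close> is open, \<open>a\<close> has to match \<open>f\<close> on
  \<open>U\<close> only; the values that a tensor assigns to points off the chart never
  matter.\<close>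

lemma pd_eq_dx:
  assumes f: "smooth_on S f" and p: "t \<in> I" "s \<in> J" "x \<in> U"
    and a: "\<And>y. y \<in> U \<Longrightarrow> a y = f (t, s, y)"
  shows "pd i a x = dx i f (t, s, x)"
proof -
  have pS: "(t, s, x) \<in> S" using p by simp
  obtain V F where F: "open V" "(t, s, x) \<in> V" "\<And>k. Ck_on k V F" "\<And>y. y \<in> V \<Longrightarrow> y \<in> S \<Longrightarrow> F y = f y"
    using smooth_onE[OF f pS] by metis
  have dF: "F differentiable (at (t, s, x))" using F(3)[of "Suc 0"] F(2) by simp
  have 1: "((\<lambda>y. (t, s, y)) has_derivative (\<lambda>v. (0, 0, v))) (at x)"
    by (auto intro!: derivative_eq_intros)
  have 2: "((\<lambda>y. F (t, s, y)) has_derivative (\<lambda>v. frechet_derivative F (at (t, s, x)) (0, 0, v))) (at x)"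
    by (rule has_derivative_compose[OF 1 has_derivative_frechet[OF dF]])
  have op: "open (U \<inter> (\<lambda>y. (t, s, y)) -` V)"
    by (intro open_Int open_U open_vimage F(1) continuous_intros)
  have "(a has_derivative (\<lambda>v. frechet_derivative F (at (t, s, x)) (0, 0, v))) (at x)"
    by (rule has_derivative_transform_within_open[OF 2 op]) (use p F(2,4) a in auto)
  from has_derivative_frechet_eq[OF this] dd_extension[OF F(1,2) pS Basis_directions(3) dF F(4)]
  show ?thesis by (simp add: pd_def)
qed

lemma has_real_derivative_dt:
  assumes f: "smooth_on S f" and p: "t \<in> I" "s \<in> J" "x \<in> U"
    and a: "\<And>\<tau>. \<tau> \<in> I \<Longrightarrow> a \<tau> = f (\<tau>, s, x)"
  shows "(a has_real_derivative dt f (t, s, x)) (at t within I)"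
proof -
  have "((\<lambda>\<tau>. f ((t, s, x) + (\<tau> - t) *\<^sub>R (1, 0, 0))) has_real_derivative dt f (t, s, x)) (at t within I)"
    by (rule has_real_derivative_dd_curve[OF f]) (use p in auto)
  thus ?thesis
    by (rule has_field_derivative_transform_within[OF _ zero_less_one p(1)]) (use a in auto)
qed

lemma td_eq_dt:
  assumes f: "smooth_on S f" and p: "t \<in> I" "s \<in> J" "x \<in> U"
    and a: "\<And>\<tau>. \<tau> \<in> I \<Longrightarrow> a \<tau> x = f (\<tau>, s, x)"
  shows "td I a t x = dt f (t, s, x)"
proof -
  have "at t within I \<noteq> bot" using islimpt_I[OF p(1)] by (simp add: trivial_limit_within)
  with has_real_derivative_dt[OF f p, of "\<lambda>\<tau>. a \<tau> x"] a show ?thesis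
    unfolding td_def by (intro vector_derivative_within)
      (auto simp: has_real_derivative_iff_has_vector_derivative)
qed

lemma has_real_derivative_ds:
  assumes f: "smooth_on S f" and p: "t \<in> I" "s \<in> J" "x \<in> U"
    and a: "\<And>\<sigma>. \<sigma> \<in> J \<Longrightarrow> a \<sigma> = f (t, \<sigma>, x)"
  shows "(a has_real_derivative ds f (t, s, x)) (at s)"
proof -
  have "((\<lambda>\<sigma>. f ((t, s, x) + (\<sigma> - s) *\<^sub>R (0, 1, 0))) has_real_derivative ds f (t, s, x)) (at s within J)"
    by (rule has_real_derivative_dd_curve[OF f]) (use p in auto)
  hence "(a has_real_derivative ds f (t, s, x)) (at s within J)"
    by (rule has_field_derivative_transform_within[OF _ zero_less_one p(2)]) (use a in auto)
  thus ?thesis using at_within_open[OF p(2) open_J] by simp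
qed

text \<open>
  Points of \<open>S\<close> are triples $(t, s, x)$. The functions below are $g_{ij}$, $g^{ij}$,
  $\Gamma^k_{ij}(t,s)$, $R_{jk}$, $R$, $\Gamma^k_{ij}(t,0)$, $W^k$, $W_j$, $|W|^2$,
  $\partial_s g_{ij}$ and its covariant derivative, and the contractions of these.
\<close>

definition "gl i j = (\<lambda>(t, s, x). G t s x $ i $ j)"
definition "gu i j = (\<lambda>(t, s, x). ginv (G t s) i j x)"
definition "\<Gamma> k i j p = 1/2 * (\<Sum>l\<in>UNIV. gu k l p * (dx i (gl j l) p + dx j (gl i l) p - dx l (gl i j) p))"
definition "Rc j k p = (\<Sum>q\<in>UNIV. dx q (\<Gamma> q j k) p - dx j (\<Gamma> q q k) p
     + (\<Sum>r\<in>UNIV. \<Gamma> r j k p * \<Gamma> q q r p) - (\<Sum>r\<in>UNIV. \<Gamma> r q k p * \<Gamma> q j r p))"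
definition "R p = (\<Sum>j\<in>UNIV. \<Sum>k\<in>UNIV. gu j k p * Rc j k p)"
definition "\<Gamma>\<^sub>0 k i j p = \<Gamma> k i j (fst p, 0, snd (snd p))"
definition "W k p = (\<Sum>i\<in>UNIV. \<Sum>j\<in>UNIV. gu i j p * (\<Gamma> k i j p - \<Gamma>\<^sub>0 k i j p))"
definition "Wl j p = (\<Sum>k\<in>UNIV. gl j k p * W k p)"
definition "N p = (\<Sum>i\<in>UNIV. \<Sum>j\<in>UNIV. gl i j p * W i p * W j p)"
definition "h i j = ds (gl i j)"
definition "Dh i j k p = dx i (h j k) p
     - (\<Sum>q\<in>UNIV. \<Gamma> q i j p * h q k p) - (\<Sum>q\<in>UNIV. \<Gamma> q i k p * h j q p)"
definition "divh j p = (\<Sum>a\<in>UNIV. \<Sum>b\<in>UNIV. gu a b p * Dh a b j p)"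
definition "divg a p = (\<Sum>j\<in>UNIV. \<Sum>k\<in>UNIV. gu j k p * (dx j (a k) p - (\<Sum>q\<in>UNIV. \<Gamma> q j k p * a q p)))"
definition "Rch p = (\<Sum>i\<in>UNIV. \<Sum>j\<in>UNIV. \<Sum>a\<in>UNIV. \<Sum>b\<in>UNIV. gu i a p * gu j b p * Rc i j p * h a b p)"

section \<open>Smoothness of the geometric fields\<close>

lemmas smooth_intros = smooth_on_const smooth_on_add smooth_on_diff smooth_on_minus smooth_on_mult smooth_on_sum
  smooth_on_divide_const  smooth_on_dd

lemma smooth_gl [simp]: "smooth_on S (gl i j)"
proof -
  have "bounded_linear (\<lambda>A :: real^'n^'n. A $ i $ j)"
    by (intro bounded_linear_compose[OF bounded_linear_vec_nth bounded_linear_vec_nth])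
  from smooth_on_bounded_linear[OF smooth_G this] show ?thesis
    by (simp add: gl_def case_prod_unfold)
qed

lemma smooth_gu [simp]: "smooth_on S (gu i j)"
proof -
  have "smooth_on S (\<lambda>p. matrix_inv (G (fst p) (fst (snd p)) (snd (snd p))) $ i $ j)"
    using smooth_gl invertible_G by (intro smooth_on_matrix_inv) (auto simp: gl_def case_prod_unfold)
  thus ?thesis by (simp add: gu_def ginv_def case_prod_unfold)
qed

lemma smooth_\<Gamma> [simp]: "smooth_on S (\<Gamma> k i j)"
  unfolding \<Gamma>_def[abs_def] by (intro smooth_intros smooth_gl smooth_gu Basis_directions)

text \<open>The projection onto s = 0 fixes the t- and x-directions and sends the s-direction to 0,
  so composition with it preserves smoothness.\<close>

lemma smooth_\<Gamma>\<^sub>0 [simp]: "smooth_on S (\<Gamma>\<^sub>0 k i j)"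
  unfolding \<Gamma>\<^sub>0_def[abs_def]
proof (rule smooth_on_compose_linear[OF smooth_\<Gamma>])
  show "bounded_linear (\<lambda>p :: real \<times> real \<times> (real^'n). (fst p, 0::real, snd (snd p)))"
    by (intro bounded_linear_intros)
qed (use zero_J in \<open>auto simp: Basis_prod_def zero_prod_def\<close>)

lemma smooth_Rc [simp]: "smooth_on S (Rc j k)"
  unfolding Rc_def[abs_def] by (intro smooth_intros smooth_\<Gamma> Basis_directions)

lemma smooth_R [simp]: "smooth_on S R"
  unfolding R_def[abs_def] by (intro smooth_intros smooth_gu smooth_Rc)

lemma smooth_W [simp]: "smooth_on S (W k)"
  unfolding W_def[abs_def] by (intro smooth_intros smooth_gu smooth_\<Gamma> smooth_\<Gamma>\<^sub>0)

lemma smooth_Wl [simp]: "smooth_on S (Wl k)"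
  unfolding Wl_def[abs_def] by (intro smooth_intros smooth_gl smooth_W)

lemma smooth_N [simp]: "smooth_on S N"
  unfolding N_def[abs_def] by (intro smooth_intros smooth_gl smooth_W)

lemma smooth_h [simp]: "smooth_on S (h i j)"
  unfolding h_def by (intro smooth_intros smooth_gl Basis_directions)

lemma smooth_Dh [simp]: "smooth_on S (Dh i j k)"
  unfolding Dh_def[abs_def] by (intro smooth_intros smooth_h smooth_\<Gamma> Basis_directions)

lemma smooth_divh [simp]: "smooth_on S (divh j)"
  unfolding divh_def[abs_def] by (intro smooth_intros smooth_gu smooth_Dh)

lemma smooth_divg: "(\<And>j. smooth_on S (a j)) \<Longrightarrow> smooth_on S (divg a)"
  unfolding divg_def[abs_def] by (intro smooth_intros smooth_gu smooth_\<Gamma> Basis_directions)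

lemma smooth_Rch [simp]: "smooth_on S Rch"
  unfolding Rch_def[abs_def] by (intro smooth_intros smooth_gu smooth_Rc smooth_h)

text \<open>\<open>m\<close> is any matrix field representing g(t,s) on \<open>U\<close>: the family
  itself in the space-time connection, the separately given flow g(t) in the extension of h.\<close>

context
  fixes t s m
  assumes t: "t \<in> I" and s: "s \<in> J" and m: "\<And>y. y \<in> U \<Longrightarrow> m y = G t s y"
begin

lemma ginv_eq: "x \<in> U \<Longrightarrow> ginv m i j x = gu i j (t, s, x)"
  by (simp add: gu_def ginv_def m)

lemma christoffel_eq: "x \<in> U \<Longrightarrow> christoffel m k i j x = \<Gamma> k i j (t, s, x)"
proof -
  assume x: "x \<in> U"
  have "pd a (comp2 m b c) x = dx a (gl b c) (t, s, x)" for a b c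
    by (rule pd_eq_dx[OF smooth_gl t s x]) (simp add: comp2_def gl_def m)
  thus ?thesis by (simp add: christoffel_def \<Gamma>_def ginv_eq x)
qed

lemma ricci_eq: "x \<in> U \<Longrightarrow> ricci m i j x = Rc i j (t, s, x)"
  by (simp add: ricci_def riem_up_def Rc_def christoffel_eq
      pd_eq_dx[OF smooth_\<Gamma> t s _ christoffel_eq])

lemma ricci_up_eq: "x \<in> U \<Longrightarrow> ricci_up m k i x = (\<Sum>q\<in>UNIV. gu k q (t, s, x) * Rc q i (t, s, x))"
  by (simp add: ricci_up_def ricci_eq ginv_eq)

lemma scal_eq: "x \<in> U \<Longrightarrow> scal m x = R (t, s, x)"
  by (simp add: scal_def R_def ricci_eq ginv_eq)

lemma grad_eq:
  assumes "x \<in> U" "smooth_on S f" "\<And>y. y \<in> U \<Longrightarrow> a y = f (t, s, y)"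
  shows "grad m a k x = (\<Sum>l\<in>UNIV. gu k l (t, s, x) * dx l f (t, s, x))"
  by (simp add: grad_def ginv_eq assms pd_eq_dx[OF assms(2) t s assms(1,3)])

lemma cd_vec_eq:
  assumes "x \<in> U" "\<And>k. smooth_on S (f k)" "\<And>k y. y \<in> U \<Longrightarrow> a k y = f k (t, s, y)"
  shows "cd_vec m a i k x = dx i (f k) (t, s, x) + (\<Sum>q\<in>UNIV. \<Gamma> k i q (t, s, x) * f q (t, s, x))"
  by (simp add: cd_vec_def christoffel_eq assms pd_eq_dx[OF assms(2) t s assms(1,3)])

lemma cd_cov_eq:
  assumes "x \<in> U" "\<And>k. smooth_on S (f k)" "\<And>k y. y \<in> U \<Longrightarrow> a k y = f k (t, s, y)"
  shows "cd_cov m a i k x = dx i (f k) (t, s, x) - (\<Sum>q\<in>UNIV. \<Gamma> q i k (t, s, x) * f q (t, s, x))"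
  by (simp add: cd_cov_def christoffel_eq assms pd_eq_dx[OF assms(2) t s assms(1,3)])

lemma deturck_eq:
  assumes x: "x \<in> U" and m': "\<And>y. y \<in> U \<Longrightarrow> m' y = G t 0 y"
  shows "deturck m m' k x = W k (t, s, x)"
proof -
  have "christoffel m' k i j x = \<Gamma> k i j (t, 0, x)" for i j
    by (rule metric_family.christoffel_eq[OF metric_family_axioms t zero_J m' x])
  thus ?thesis by (simp add: deturck_def W_def \<Gamma>\<^sub>0_def christoffel_eq ginv_eq x)
qed

lemma lower_deturck_eq:
  assumes "x \<in> U" "\<And>y. y \<in> U \<Longrightarrow> m' y = G t 0 y"
  shows "lower m (deturck m m') j x = Wl j (t, s, x)"
  using assms by (simp add: lower_def Wl_def deturck_eq gl_def m)

lemma norm_sq_deturck_eq: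
  assumes "x \<in> U" "\<And>y. y \<in> U \<Longrightarrow> m' y = G t 0 y"
  shows "norm_sq m (deturck m m') x = N (t, s, x)"
  using assms by (simp add: norm_sq_def N_def deturck_eq gl_def m)

context
  fixes hm
  assumes hm: "\<And>i j y. y \<in> U \<Longrightarrow> hm y $ i $ j = h i j (t, s, y)"
begin

lemma cd_cov2_eq: "x \<in> U \<Longrightarrow> cd_cov2 m (comp2 hm) i j k x = Dh i j k (t, s, x)"
  by (simp add: cd_cov2_def Dh_def christoffel_eq pd_eq_dx[OF smooth_h t s] comp2_def[abs_def] hm)

lemma div2_eq: "x \<in> U \<Longrightarrow> div2 m hm j x = divh j (t, s, x)"
  by (simp add: div2_def divh_def cd_cov2_eq ginv_eq)

lemma div1_div2_eq: "x \<in> U \<Longrightarrow> div1 m (div2 m hm) x = divg divh (t, s, x)"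
  by (simp add: div1_def divg_def cd_cov_eq[OF _ smooth_divh div2_eq] ginv_eq)

lemma ricci_dot_eq: "x \<in> U \<Longrightarrow> ricci_dot m hm x = Rch (t, s, x)"
  by (simp add: ricci_dot_def Rch_def ricci_eq ginv_eq hm)

end

end

end

section \<open>Index calculus\<close>

lemma sum3_swap13: "(\<Sum>a\<in>A. \<Sum>b\<in>B. \<Sum>c\<in>C. f a b c) = (\<Sum>c\<in>C. \<Sum>b\<in>B. \<Sum>a\<in>A. f a b c)"
proof -
  have "(\<Sum>a\<in>A. \<Sum>b\<in>B. \<Sum>c\<in>C. f a b c) = (\<Sum>a\<in>A. \<Sum>c\<in>C. \<Sum>b\<in>B. f a b c)"
    by (intro sum.cong refl sum.swap)
  also have "\<dots> = (\<Sum>c\<in>C. \<Sum>a\<in>A. \<Sum>b\<in>B. f a b c)" by (rule sum.swap)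
  also have "\<dots> = (\<Sum>c\<in>C. \<Sum>b\<in>B. \<Sum>a\<in>A. f a b c)" by (intro sum.cong refl sum.swap)
  finally show ?thesis .
qed

lemma sum3_rotate: "(\<Sum>a\<in>A. \<Sum>b\<in>B. \<Sum>c\<in>C. f a b c) = (\<Sum>b\<in>B. \<Sum>c\<in>C. \<Sum>a\<in>A. f a b c)"
proof -
  have "(\<Sum>a\<in>A. \<Sum>b\<in>B. \<Sum>c\<in>C. f a b c) = (\<Sum>b\<in>B. \<Sum>a\<in>A. \<Sum>c\<in>C. f a b c)" by (rule sum.swap)
  also have "\<dots> = (\<Sum>b\<in>B. \<Sum>c\<in>C. \<Sum>a\<in>A. f a b c)" by (intro sum.cong refl sum.swap)
  finally show ?thesis .
qed

lemma sum4_rotate2: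
  "(\<Sum>a\<in>A. \<Sum>b\<in>B. \<Sum>c\<in>C. \<Sum>d\<in>D. f a b c d) = (\<Sum>c\<in>C. \<Sum>d\<in>D. \<Sum>a\<in>A. \<Sum>b\<in>B. f a b c d)"
proof -
  have "(\<Sum>a\<in>A. \<Sum>b\<in>B. \<Sum>c\<in>C. \<Sum>d\<in>D. f a b c d) = (\<Sum>a\<in>A. \<Sum>c\<in>C. \<Sum>d\<in>D. \<Sum>b\<in>B. f a b c d)"
    by (intro sum.cong refl sum3_rotate)
  also have "\<dots> = (\<Sum>c\<in>C. \<Sum>d\<in>D. \<Sum>a\<in>A. \<Sum>b\<in>B. f a b c d)" by (rule sum3_rotate)
  finally show ?thesis .
qed

lemma sum4_swap14:
  "(\<Sum>a\<in>A. \<Sum>b\<in>B. \<Sum>c\<in>C. \<Sum>d\<in>D. f a b c d) = (\<Sum>d\<in>D. \<Sum>b\<in>B. \<Sum>c\<in>C. \<Sum>a\<in>A. f a b c d)"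
proof -
  have "(\<Sum>a\<in>A. \<Sum>b\<in>B. \<Sum>c\<in>C. \<Sum>d\<in>D. f a b c d) = (\<Sum>a\<in>A. \<Sum>d\<in>D. \<Sum>c\<in>C. \<Sum>b\<in>B. f a b c d)"
    by (intro sum.cong refl sum3_swap13)
  also have "\<dots> = (\<Sum>d\<in>D. \<Sum>a\<in>A. \<Sum>c\<in>C. \<Sum>b\<in>B. f a b c d)" by (rule sum.swap)
  also have "\<dots> = (\<Sum>d\<in>D. \<Sum>b\<in>B. \<Sum>c\<in>C. \<Sum>a\<in>A. f a b c d)"
    by (intro sum.cong refl sum3_swap13)
  finally show ?thesis .
qed

context metric_family
begin

declare smooth_intros [simp]

lemma gl_sym: "p \<in> S \<Longrightarrow> gl i j p = gl j i p"
  using sym_G by (auto simp: gl_def transpose_def vec_eq_iff)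

lemma dd_gl_sym: "p \<in> S \<Longrightarrow> dd S b (gl i j) p = dd S b (gl j i) p"
  by (rule dd_cong) (auto intro: gl_sym)

lemma gl_gu: "p \<in> S \<Longrightarrow> (\<Sum>k\<in>UNIV. gl i k p * gu k j p) = (if i = j then 1 else 0)"
  using arg_cong[OF matrix_inv_inverse(1)[OF invertible_G], of _ _ _ "\<lambda>A. A $ i $ j"]
  by (auto simp: gl_def gu_def ginv_def matrix_matrix_mult_def mat_def)

lemma gu_gl: "p \<in> S \<Longrightarrow> (\<Sum>k\<in>UNIV. gu i k p * gl k j p) = (if i = j then 1 else 0)"
  using arg_cong[OF matrix_inv_inverse(2)[OF invertible_G], of _ _ _ "\<lambda>A. A $ i $ j"]
  by (auto simp: gl_def gu_def ginv_def matrix_matrix_mult_def mat_def)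

text \<open>\<open>a\<close> is any family of numbers, not necessarily a tensor: derivatives of
  g^{ij} and Christoffel symbols will be inserted, too.\<close>

lemma raise_lower: "p \<in> S \<Longrightarrow> (\<Sum>l\<in>UNIV. gu k l p * (\<Sum>m\<in>UNIV. gl l m p * a m)) = a k"
proof -
  assume p: "p \<in> S"
  have "(\<Sum>l\<in>UNIV. gu k l p * (\<Sum>m\<in>UNIV. gl l m p * a m)) = (\<Sum>l\<in>UNIV. \<Sum>m\<in>UNIV. gu k l p * gl l m p * a m)"
    by (simp add: sum_distrib_left mult.assoc)
  also have "\<dots> = (\<Sum>m\<in>UNIV. \<Sum>l\<in>UNIV. gu k l p * gl l m p * a m)" by (rule sum.swap)
  also have "\<dots> = (\<Sum>m\<in>UNIV. (\<Sum>l\<in>UNIV. gu k l p * gl l m p) * a m)" by (simp add: sum_distrib_right)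
  also have "\<dots> = a k" by (simp add: gu_gl[OF p] mult_delta_left)
  finally show ?thesis .
qed

lemma lower_raise: "p \<in> S \<Longrightarrow> (\<Sum>l\<in>UNIV. gl k l p * (\<Sum>m\<in>UNIV. gu l m p * a m)) = a k"
proof -
  assume p: "p \<in> S"
  have "(\<Sum>l\<in>UNIV. gl k l p * (\<Sum>m\<in>UNIV. gu l m p * a m)) = (\<Sum>l\<in>UNIV. \<Sum>m\<in>UNIV. gl k l p * gu l m p * a m)"
    by (simp add: sum_distrib_left mult.assoc)
  also have "\<dots> = (\<Sum>m\<in>UNIV. \<Sum>l\<in>UNIV. gl k l p * gu l m p * a m)" by (rule sum.swap)
  also have "\<dots> = (\<Sum>m\<in>UNIV. (\<Sum>l\<in>UNIV. gl k l p * gu l m p) * a m)" by (simp add: sum_distrib_right)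
  also have "\<dots> = a k" by (simp add: gl_gu[OF p] mult_delta_left)
  finally show ?thesis .
qed

text \<open>By symmetry of g_{kl}, row j of the inverse solves the same linear system as column j,
  and the solution is unique.\<close>

lemma gu_sym: "p \<in> S \<Longrightarrow> gu i j p = gu j i p"
proof -
  assume p: "p \<in> S"
  have "(\<Sum>l\<in>UNIV. gl k l p * gu j l p) = (\<Sum>l\<in>UNIV. gu j l p * gl l k p)" for k
    using gl_sym[OF p] by (simp add: mult.commute)
  hence "(\<Sum>l\<in>UNIV. gl k l p * gu j l p) = (if k = j then 1 else 0)" for k
    using gu_gl[OF p, of j k] by auto
  hence "gu j i p = (\<Sum>k\<in>UNIV. gu i k p * (if k = j then 1 else 0))"
    using raise_lower[OF p, of i "\<lambda>i. gu j i p"] by simp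
  thus ?thesis by (simp add: mult_delta_right)
qed

lemma gl_dd_gu:
  assumes p: "p \<in> S" and b: "b \<in> Basis"
  shows "(\<Sum>k\<in>UNIV. gl m k p * dd S b (gu k j) p) = - (\<Sum>k\<in>UNIV. dd S b (gl m k) p * gu k j p)"
proof -
  have "dd S b (\<lambda>q. \<Sum>k\<in>UNIV. gl m k q * gu k j q) p = dd S b (\<lambda>q. if m = j then 1 else 0) p"
    by (rule dd_cong[OF p gl_gu])
  thus ?thesis by (simp add: dd_sum dd_mult sum.distrib dd_const p b)
qed

text \<open>The equation g g^{-1} = 1 is differentiated and solved for the derivative of the
  inverse. The direction is left general because both t and s will be used.\<close>

lemma dd_gu:
  assumes p: "p \<in> S" and b: "b \<in> Basis"
  shows "dd S b (gu i j) p = - (\<Sum>k\<in>UNIV. \<Sum>l\<in>UNIV. gu i k p * dd S b (gl k l) p * gu l j p)"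
  using raise_lower[OF p, of i "\<lambda>k. dd S b (gu k j) p"]
  by (simp add: gl_dd_gu[OF p b] sum_negf sum_distrib_left mult.assoc)

lemma lower_\<Gamma>:
  assumes p: "p \<in> S"
  shows "(\<Sum>k\<in>UNIV. gl l k p * \<Gamma> k i j p) = 1/2 * (dx i (gl j l) p + dx j (gl i l) p - dx l (gl i j) p)"
  using lower_raise[OF p, of l "\<lambda>l. 1/2 * (dx i (gl j l) p + dx j (gl i l) p - dx l (gl i j) p)"]
  by (simp add: \<Gamma>_def sum_distrib_left)

lemma \<Gamma>_sym: "p \<in> S \<Longrightarrow> \<Gamma> k i j p = \<Gamma> k j i p"
  using dd_gl_sym[of p _ i j] by (simp add: \<Gamma>_def add.commute)

text \<open>Compatibility of the connection with g, in coordinates: in the sum of the two lowered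
  Christoffel symbols all other derivatives cancel.\<close>

lemma dx_gl:
  assumes p: "p \<in> S"
  shows "dx q (gl i j) p = (\<Sum>k\<in>UNIV. gl j k p * \<Gamma> k q i p) + (\<Sum>k\<in>UNIV. gl i k p * \<Gamma> k q j p)"
  using dd_gl_sym[OF p, of _ i j] by (simp add: lower_\<Gamma>[OF p] field_simps)

text \<open>This says that g^{-1} is parallel. The first index is lowered, so that the derivative of
  g g^{-1} = 1 and compatibility with g apply, and raised again at the end.\<close>

lemma dx_gu:
  assumes p: "p \<in> S"
  shows "dx q (gu i j) p = - (\<Sum>k\<in>UNIV. \<Gamma> i q k p * gu k j p) - (\<Sum>k\<in>UNIV. \<Gamma> j q k p * gu i k p)"
proof -
  have "(\<Sum>k\<in>UNIV. gl m k p * dx q (gu k j) p) = - \<Gamma> j q m p - (\<Sum>r\<in>UNIV. gl m r p * (\<Sum>k\<in>UNIV. \<Gamma> r q k p * gu k j p))" for m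
  proof -
    have "(\<Sum>k\<in>UNIV. (\<Sum>r\<in>UNIV. gl k r p * \<Gamma> r q m p) * gu k j p) = (\<Sum>k\<in>UNIV. gu j k p * (\<Sum>r\<in>UNIV. gl k r p * \<Gamma> r q m p))"
      using gu_sym[OF p] by (simp add: mult.commute)
    hence 1: "(\<Sum>k\<in>UNIV. (\<Sum>r\<in>UNIV. gl k r p * \<Gamma> r q m p) * gu k j p) = \<Gamma> j q m p"
      using raise_lower[OF p, of j "\<lambda>r. \<Gamma> r q m p"] by simp
    have "(\<Sum>k\<in>UNIV. (\<Sum>r\<in>UNIV. gl m r p * \<Gamma> r q k p) * gu k j p) = (\<Sum>k\<in>UNIV. \<Sum>r\<in>UNIV. gl m r p * (\<Gamma> r q k p * gu k j p))"
      by (simp add: sum_distrib_right mult.assoc)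
    also have "\<dots> = (\<Sum>r\<in>UNIV. \<Sum>k\<in>UNIV. gl m r p * (\<Gamma> r q k p * gu k j p))" by (rule sum.swap)
    also have "\<dots> = (\<Sum>r\<in>UNIV. gl m r p * (\<Sum>k\<in>UNIV. \<Gamma> r q k p * gu k j p))" by (simp add: sum_distrib_left)
    finally have 2: "(\<Sum>k\<in>UNIV. (\<Sum>r\<in>UNIV. gl m r p * \<Gamma> r q k p) * gu k j p) = \<dots>" .
    show ?thesis
      using 1 2 by (simp add: gl_dd_gu[OF p] dx_gl[OF p] distrib_right sum.distrib)
  qed
  hence "dx q (gu i j) p = (\<Sum>m\<in>UNIV. gu i m p * (- \<Gamma> j q m p - (\<Sum>r\<in>UNIV. gl m r p * (\<Sum>k\<in>UNIV. \<Gamma> r q k p * gu k j p))))"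
    using raise_lower[OF p, of i "\<lambda>k. dx q (gu k j) p"] by simp
  also have "\<dots> = - (\<Sum>m\<in>UNIV. gu i m p * \<Gamma> j q m p) - (\<Sum>k\<in>UNIV. \<Gamma> i q k p * gu k j p)"
    using raise_lower[OF p, of i "\<lambda>r. \<Sum>k\<in>UNIV. \<Gamma> r q k p * gu k j p"]
    by (simp add: right_diff_distrib sum_subtractf sum_negf)
  finally show ?thesis by (simp add: mult.commute)
qed

text \<open>
  \<open>C\<close> is the $s$-derivative of the connection; \<open>V\<close> is that of \<open>W\<close> only at $s = 0$.
\<close>

definition "C k i j = ds (\<Gamma> k i j)"
definition "V k p = (\<Sum>i\<in>UNIV. \<Sum>j\<in>UNIV. gu i j p * C k i j p)"
definition "Vl j p = (\<Sum>k\<in>UNIV. gl j k p * V k p)"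
definition "tr p = (\<Sum>i\<in>UNIV. \<Sum>j\<in>UNIV. gu i j p * h i j p)"

lemma smooth_C [simp]: "smooth_on S (C k i j)"
  unfolding C_def by simp

lemma smooth_V [simp]: "smooth_on S (V k)"
  unfolding V_def[abs_def] by simp

lemma smooth_Vl [simp]: "smooth_on S (Vl k)"
  unfolding Vl_def[abs_def] by simp

lemma smooth_tr [simp]: "smooth_on S tr"
  unfolding tr_def[abs_def] by simp

lemma h_sym: "p \<in> S \<Longrightarrow> h i j p = h j i p"
  unfolding h_def by (rule dd_gl_sym)

lemma dd_h_sym: "p \<in> S \<Longrightarrow> dd S b (h i j) p = dd S b (h j i) p"
  by (rule dd_cong) (auto intro: h_sym)

lemma C_sym: "p \<in> S \<Longrightarrow> C k i j p = C k j i p"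
  unfolding C_def by (rule dd_cong) (auto intro: \<Gamma>_sym)

lemma Dh_sym: "p \<in> S \<Longrightarrow> Dh l i j p = Dh l j i p"
  using dd_h_sym[of p _ i j] by (simp add: Dh_def h_sym[of p j] h_sym[of p i])

text \<open>The s-derivative is taken of the Christoffel symbols with lowered index, which contain
  no g^{kl}. The product rule leaves a term \<Gamma> h, and this is exactly what survives of the
  connection terms in the combination of three covariant derivatives.\<close>

lemma lower_C:
  assumes p: "p \<in> S"
  shows "(\<Sum>k\<in>UNIV. gl l k p * C k i j p) = 1/2 * (Dh i j l p + Dh j i l p - Dh l i j p)"
proof -
  have "ds (\<lambda>q. \<Sum>k\<in>UNIV. gl l k q * \<Gamma> k i j q) p =
      ds (\<lambda>q. 1/2 * (dx i (gl j l) q + dx j (gl i l) q - dx l (gl i j) q)) p"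
    by (rule dd_cong[OF p lower_\<Gamma>])
  hence "(\<Sum>k\<in>UNIV. gl l k p * C k i j p) + (\<Sum>k\<in>UNIV. \<Gamma> k i j p * h k l p)
      = 1/2 * (dx i (h j l) p + dx j (h i l) p - dx l (h i j) p)"
    using dd_commute[of _ "(0, 1, 0)" "(0, 0, axis _ 1)" p] h_sym[OF p, of l]
    by (simp add: dd_sum dd_mult dd_divide dd_add dd_diff p sum.distrib C_def h_def mult.commute)
  moreover have "Dh i j l p + Dh j i l p - Dh l i j p
      = dx i (h j l) p + dx j (h i l) p - dx l (h i j) p - 2 * (\<Sum>k\<in>UNIV. \<Gamma> k i j p * h k l p)"
    using \<Gamma>_sym[OF p, of _ j i] \<Gamma>_sym[OF p, of _ l i] \<Gamma>_sym[OF p, of _ l j] h_sym[OF p, of i] h_sym[OF p, of j]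
    by (simp add: Dh_def)
  ultimately show ?thesis by simp
qed

lemma C_eq:
  assumes p: "p \<in> S"
  shows "C k i j p = (\<Sum>l\<in>UNIV. gu k l p * (1/2 * (Dh i j l p + Dh j i l p - Dh l i j p)))"
  using raise_lower[OF p, of k "\<lambda>k. C k i j p"] by (simp add: lower_C[OF p])

text \<open>Traces commute with covariant derivatives because g^{-1} is parallel: the derivative of
  g^{ij} supplies the connection terms of \<open>Dh\<close>.\<close>

lemma dx_tr:
  assumes p: "p \<in> S"
  shows "dx k tr p = (\<Sum>i\<in>UNIV. \<Sum>j\<in>UNIV. gu i j p * Dh k i j p)"
proof -
  have 1: "(\<Sum>i\<in>UNIV. \<Sum>j\<in>UNIV. (\<Sum>r\<in>UNIV. \<Gamma> i k r p * gu r j p) * h i j p) = (\<Sum>i\<in>UNIV. \<Sum>j\<in>UNIV. gu i j p * (\<Sum>q\<in>UNIV. \<Gamma> q k i p * h q j p))"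
    unfolding sum_distrib_right sum_distrib_left
    by (subst sum3_swap13) (simp add: mult_ac)
  have 2: "(\<Sum>i\<in>UNIV. \<Sum>j\<in>UNIV. (\<Sum>r\<in>UNIV. \<Gamma> j k r p * gu i r p) * h i j p) = (\<Sum>i\<in>UNIV. \<Sum>j\<in>UNIV. gu i j p * (\<Sum>q\<in>UNIV. \<Gamma> q k j p * h i q p))"
    unfolding sum_distrib_right sum_distrib_left
    by (rule sum.cong[OF refl], subst sum.swap) (simp add: mult_ac)
  have "dx k tr p = (\<Sum>i\<in>UNIV. \<Sum>j\<in>UNIV. dx k (gu i j) p * h i j p + gu i j p * dx k (h i j) p)"
    unfolding tr_def[abs_def] by (simp add: dd_sum dd_mult p)
  also have "\<dots> = (\<Sum>i\<in>UNIV. \<Sum>j\<in>UNIV. gu i j p * dx k (h i j) p)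
      - (\<Sum>i\<in>UNIV. \<Sum>j\<in>UNIV. (\<Sum>r\<in>UNIV. \<Gamma> i k r p * gu r j p) * h i j p) - (\<Sum>i\<in>UNIV. \<Sum>j\<in>UNIV. (\<Sum>r\<in>UNIV. \<Gamma> j k r p * gu i r p) * h i j p)"
    by (simp add: dx_gu[OF p] left_diff_distrib sum.distrib sum_subtractf sum_negf)
  also have "\<dots> = (\<Sum>i\<in>UNIV. \<Sum>j\<in>UNIV. gu i j p * Dh k i j p)"
    unfolding 1 2 by (simp add: Dh_def right_diff_distrib sum_subtractf)
  finally show ?thesis .
qed

text \<open>The linearization of \<Gamma>^q_{qk} = d_k log sqrt(det g). In the formula for
  \<open>C\<close> the first and the third term cancel in the trace, since g^{ql} and h are
  symmetric.\<close>

lemma trace_C: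
  assumes p: "p \<in> S"
  shows "(\<Sum>q\<in>UNIV. C q q k p) = 1/2 * dx k tr p"
proof -
  have "(\<Sum>q\<in>UNIV. \<Sum>l\<in>UNIV. gu q l p * Dh l q k p) = (\<Sum>q\<in>UNIV. \<Sum>l\<in>UNIV. gu q l p * Dh q l k p)"
    by (subst sum.swap) (simp add: gu_sym[OF p])
  hence 1: "(\<Sum>q\<in>UNIV. \<Sum>l\<in>UNIV. gu q l p * Dh q k l p) = (\<Sum>q\<in>UNIV. \<Sum>l\<in>UNIV. gu q l p * Dh l q k p)"
    using Dh_sym[OF p, of _ k] by simp
  have "(\<Sum>q\<in>UNIV. C q q k p) = 1/2 * ((\<Sum>q\<in>UNIV. \<Sum>l\<in>UNIV. gu q l p * Dh q k l p) + (\<Sum>q\<in>UNIV. \<Sum>l\<in>UNIV. gu q l p * Dh k q l p)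
      - (\<Sum>q\<in>UNIV. \<Sum>l\<in>UNIV. gu q l p * Dh l q k p))"
    by (simp add: C_eq[OF p] sum_distrib_left distrib_left right_diff_distrib sum.distrib sum_subtractf
        sum_divide_distrib add_divide_distrib diff_divide_distrib)
  thus ?thesis using 1 by (simp add: dx_tr[OF p])
qed

text \<open>The trace of \<open>lower_C\<close>, whose first two terms agree by symmetry of g^{ij}.
  As \<open>V\<close> is built from \<open>C\<close>, this holds for every s and may be
  differentiated in any direction.\<close>

lemma Vl_eq:
  assumes p: "p \<in> S"
  shows "Vl l p = divh l p - 1/2 * dx l tr p"
proof -
  have "Vl l p = (\<Sum>k\<in>UNIV. \<Sum>i\<in>UNIV. \<Sum>j\<in>UNIV. gu i j p * (gl l k p * C k i j p))"
    by (simp add: Vl_def V_def sum_distrib_left mult_ac)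
  also have "\<dots> = (\<Sum>i\<in>UNIV. \<Sum>j\<in>UNIV. \<Sum>k\<in>UNIV. gu i j p * (gl l k p * C k i j p))" by (rule sum3_rotate)
  also have "\<dots> = (\<Sum>i\<in>UNIV. \<Sum>j\<in>UNIV. gu i j p * (1/2 * (Dh i j l p + Dh j i l p - Dh l i j p)))"
    by (simp only: sum_distrib_left[symmetric] lower_C[OF p])
  also have "\<dots> = 1/2 * ((\<Sum>i\<in>UNIV. \<Sum>j\<in>UNIV. gu i j p * Dh i j l p) + (\<Sum>i\<in>UNIV. \<Sum>j\<in>UNIV. gu i j p * Dh j i l p)
      - (\<Sum>i\<in>UNIV. \<Sum>j\<in>UNIV. gu i j p * Dh l i j p))"
    by (simp add: sum_distrib_left distrib_left right_diff_distrib sum.distrib sum_subtractf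
        sum_divide_distrib add_divide_distrib diff_divide_distrib)
  also have "(\<Sum>i\<in>UNIV. \<Sum>j\<in>UNIV. gu i j p * Dh j i l p) = (\<Sum>i\<in>UNIV. \<Sum>j\<in>UNIV. gu i j p * Dh i j l p)"
    by (subst sum.swap) (simp add: gu_sym[OF p])
  finally show ?thesis by (simp add: dx_tr[OF p] divh_def)
qed

section \<open>Variation of the curvature\<close>

text \<open>Raising an index commutes with covariant differentiation, again because g^{-1} is
  parallel.\<close>

lemma raise_cd_Vl:
  assumes p: "p \<in> S"
  shows "(\<Sum>l\<in>UNIV. gu k l p * (dx i (Vl l) p - (\<Sum>q\<in>UNIV. \<Gamma> q i l p * Vl q p)))
    = dx i (V k) p + (\<Sum>q\<in>UNIV. \<Gamma> k i q p * V q p)"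
proof -
  have V: "V k q = (\<Sum>l\<in>UNIV. gu k l q * Vl l q)" if "q \<in> S" for k q
    using raise_lower[OF that, of k "\<lambda>k. V k q"] by (simp add: Vl_def)
  have 1: "(\<Sum>l\<in>UNIV. (\<Sum>r\<in>UNIV. \<Gamma> k i r p * gu r l p) * Vl l p) = (\<Sum>r\<in>UNIV. \<Gamma> k i r p * V r p)"
    unfolding V[OF p] sum_distrib_right sum_distrib_left
    by (subst sum.swap) (simp add: mult_ac)
  have 2: "(\<Sum>l\<in>UNIV. (\<Sum>r\<in>UNIV. \<Gamma> l i r p * gu k r p) * Vl l p) = (\<Sum>l\<in>UNIV. gu k l p * (\<Sum>q\<in>UNIV. \<Gamma> q i l p * Vl q p))"
    unfolding sum_distrib_right sum_distrib_left
    by (subst sum.swap) (simp add: mult_ac)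
  have "dx i (V k) p = dx i (\<lambda>q. \<Sum>l\<in>UNIV. gu k l q * Vl l q) p"
    by (rule dd_cong[OF p V])
  also have "\<dots> = (\<Sum>l\<in>UNIV. gu k l p * dx i (Vl l) p)
      - (\<Sum>l\<in>UNIV. (\<Sum>r\<in>UNIV. \<Gamma> k i r p * gu r l p) * Vl l p) - (\<Sum>l\<in>UNIV. (\<Sum>r\<in>UNIV. \<Gamma> l i r p * gu k r p) * Vl l p)"
    by (simp add: dd_sum dd_mult p dx_gu[OF p] left_diff_distrib sum.distrib sum_subtractf sum_negf)
  finally show ?thesis
    unfolding 1 2 by (simp add: right_diff_distrib sum_subtractf)
qed

lemma divg_Vl:
  assumes p: "p \<in> S"
  shows "divg Vl p = (\<Sum>q\<in>UNIV. dx q (V q) p) + (\<Sum>q\<in>UNIV. \<Sum>r\<in>UNIV. \<Gamma> q q r p * V r p)"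
  by (simp add: divg_def raise_cd_Vl[OF p] sum.distrib)

lemma divg_Vl_eq:
  assumes p: "p \<in> S"
  shows "divg Vl p = divg divh p - 1/2 * divg (\<lambda>k. dx k tr) p"
proof -
  have e: "dx j (Vl k) p = dx j (divh k) p - 1/2 * dx j (dx k tr) p" for j k
  proof -
    have "dx j (Vl k) p = dx j (\<lambda>q. divh k q - 1/2 * dx k tr q) p"
      by (rule dd_cong[OF p Vl_eq])
    thus ?thesis by (simp add: dd_diff dd_divide p)
  qed
  have "divg Vl p = (\<Sum>j\<in>UNIV. \<Sum>k\<in>UNIV. gu j k p * (dx j (divh k) p - (\<Sum>q\<in>UNIV. \<Gamma> q j k p * divh q p))
      - 1/2 * (gu j k p * (dx j (dx k tr) p - (\<Sum>q\<in>UNIV. \<Gamma> q j k p * dx q tr p))))"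
    unfolding divg_def e Vl_eq[OF p]
    by (intro sum.cong refl)
      (simp add: right_diff_distrib sum_subtractf sum_divide_distrib[symmetric] diff_divide_distrib)
  thus ?thesis
    by (simp add: divg_def sum_subtractf sum_divide_distrib)
qed

text \<open>The variation is left in partial derivatives and Christoffel symbols; covariant
  expressions are assembled only after the trace is taken.\<close>

lemma ds_Rc:
  assumes p: "p \<in> S"
  shows "ds (Rc j k) p = (\<Sum>q\<in>UNIV. dx q (C q j k) p - dx j (C q q k) p
     + (\<Sum>r\<in>UNIV. C r j k p * \<Gamma> q q r p + \<Gamma> r j k p * C q q r p)
     - (\<Sum>r\<in>UNIV. C r q k p * \<Gamma> q j r p + \<Gamma> r q k p * C q j r p))"
  unfolding Rc_def[abs_def]
  by (simp add: dd_sum dd_mult dd_add dd_diff p C_def dd_commute[of _ "(0, 1, 0)" "(0, 0, axis _ 1)" p])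

text \<open>The trace of the Palatini formula nabla_q C^q_{jk} - nabla_j C^q_{qk} for the variation
  of R_{jk}: the first term gives div V, the second, by \<open>trace_C\<close>, half the Laplacian
  of the trace of h.\<close>

lemma trace_ds_Rc:
  assumes p: "p \<in> S"
  shows "(\<Sum>j\<in>UNIV. \<Sum>k\<in>UNIV. gu j k p * ds (Rc j k) p) = divg Vl p - 1/2 * divg (\<lambda>k. dx k tr) p"
proof -
  \<comment> \<open>\<open>E1\<close> and \<open>E2\<close> arise when the derivative of V^q falls
    on g^{jk}; they will cancel against quadratic terms of the Ricci variation.\<close>
  define E1 where "E1 = (\<Sum>q\<in>UNIV. \<Sum>j\<in>UNIV. \<Sum>k\<in>UNIV. \<Sum>r\<in>UNIV. \<Gamma> j q r p * gu r k p * C q j k p)"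
  define E2 where "E2 = (\<Sum>q\<in>UNIV. \<Sum>j\<in>UNIV. \<Sum>k\<in>UNIV. \<Sum>r\<in>UNIV. \<Gamma> k q r p * gu j r p * C q j k p)"
  have "dx q (V q) p = (\<Sum>j\<in>UNIV. \<Sum>k\<in>UNIV. gu j k p * dx q (C q j k) p)
      - (\<Sum>j\<in>UNIV. \<Sum>k\<in>UNIV. \<Sum>r\<in>UNIV. \<Gamma> j q r p * gu r k p * C q j k p)
      - (\<Sum>j\<in>UNIV. \<Sum>k\<in>UNIV. \<Sum>r\<in>UNIV. \<Gamma> k q r p * gu j r p * C q j k p)" for q
    unfolding V_def[abs_def]
    by (simp add: dd_sum dd_mult p dx_gu[OF p] left_diff_distrib sum.distrib sum_subtractf sum_negf
        sum_distrib_right)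
  hence "(\<Sum>q\<in>UNIV. dx q (V q) p) = (\<Sum>q\<in>UNIV. \<Sum>j\<in>UNIV. \<Sum>k\<in>UNIV. gu j k p * dx q (C q j k) p) - E1 - E2"
    by (simp add: sum_subtractf E1_def E2_def)
  moreover have "(\<Sum>q\<in>UNIV. \<Sum>j\<in>UNIV. \<Sum>k\<in>UNIV. gu j k p * dx q (C q j k) p) = (\<Sum>j\<in>UNIV. \<Sum>k\<in>UNIV. \<Sum>q\<in>UNIV. gu j k p * dx q (C q j k) p)"
    by (rule sum3_rotate)
  ultimately have T1: "(\<Sum>j\<in>UNIV. \<Sum>k\<in>UNIV. \<Sum>q\<in>UNIV. gu j k p * dx q (C q j k) p) = (\<Sum>q\<in>UNIV. dx q (V q) p) + E1 + E2"
    by simp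
  have e: "(\<Sum>q\<in>UNIV. dx j (C q q k) p) = 1/2 * dx j (dx k tr) p" for j k
  proof -
    have "dx j (\<lambda>q. \<Sum>i\<in>UNIV. C i i k q) p = dx j (\<lambda>q. 1/2 * dx k tr q) p"
      by (rule dd_cong[OF p trace_C])
    thus ?thesis by (simp add: dd_sum dd_divide p)
  qed
  have T2: "(\<Sum>j\<in>UNIV. \<Sum>k\<in>UNIV. \<Sum>q\<in>UNIV. gu j k p * dx j (C q q k) p) = 1/2 * (\<Sum>j\<in>UNIV. \<Sum>k\<in>UNIV. gu j k p * dx j (dx k tr) p)"
    unfolding sum_distrib_left[symmetric] e by (simp add: sum_divide_distrib)
  \<comment> \<open>The term \<Gamma>^q_{qr} V^r that completes the divergence of V.\<close>
  have T3: "(\<Sum>j\<in>UNIV. \<Sum>k\<in>UNIV. \<Sum>q\<in>UNIV. \<Sum>r\<in>UNIV. gu j k p * (C r j k p * \<Gamma> q q r p)) = (\<Sum>q\<in>UNIV. \<Sum>r\<in>UNIV. \<Gamma> q q r p * V r p)"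
    by (subst sum4_rotate2) (simp add: V_def sum_distrib_left mult_ac)
  \<comment> \<open>The connection term of the Laplacian of the trace, whose second derivatives are
    in \<open>T2\<close>.\<close>
  have T4: "(\<Sum>j\<in>UNIV. \<Sum>k\<in>UNIV. \<Sum>q\<in>UNIV. \<Sum>r\<in>UNIV. gu j k p * (\<Gamma> r j k p * C q q r p))
      = 1/2 * (\<Sum>j\<in>UNIV. \<Sum>k\<in>UNIV. gu j k p * (\<Sum>r\<in>UNIV. \<Gamma> r j k p * dx r tr p))"
  proof -
    have e: "(\<Sum>q\<in>UNIV. \<Sum>r\<in>UNIV. gu j k p * (\<Gamma> r j k p * C q q r p))
        = gu j k p * (\<Sum>r\<in>UNIV. \<Gamma> r j k p * dx r tr p) / 2" for j k
    proof -
      have "(\<Sum>q\<in>UNIV. \<Sum>r\<in>UNIV. gu j k p * (\<Gamma> r j k p * C q q r p))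
          = (\<Sum>r\<in>UNIV. \<Sum>q\<in>UNIV. gu j k p * (\<Gamma> r j k p * C q q r p))"
        by (rule sum.swap)
      also have "\<dots> = (\<Sum>r\<in>UNIV. gu j k p * (\<Gamma> r j k p * (1/2 * dx r tr p)))"
        by (simp only: sum_distrib_left[symmetric] trace_C[OF p])
      finally show ?thesis by (simp add: sum_distrib_left sum_divide_distrib)
    qed
    show ?thesis unfolding e by (simp add: sum_divide_distrib)
  qed
  \<comment> \<open>Bound indices are renamed; the rest is symmetry of \<open>C\<close>, \<Gamma>
    and g^{-1}. The same works for \<open>T6\<close>.\<close>
  have T5: "(\<Sum>j\<in>UNIV. \<Sum>k\<in>UNIV. \<Sum>q\<in>UNIV. \<Sum>r\<in>UNIV. gu j k p * (C r q k p * \<Gamma> q j r p)) = E2"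
    unfolding E2_def
    by (subst sum4_swap14, rule sum.cong[OF refl], rule sum.cong[OF refl],
        rule sum.cong[OF refl], rule sum.cong[OF refl])
      (metis C_sym[OF p] \<Gamma>_sym[OF p] gu_sym[OF p] mult.commute mult.left_commute)
  have T6: "(\<Sum>j\<in>UNIV. \<Sum>k\<in>UNIV. \<Sum>q\<in>UNIV. \<Sum>r\<in>UNIV. gu j k p * (\<Gamma> r q k p * C q j r p)) = E1"
    unfolding E1_def
    by (subst sum4_rotate2, rule sum.cong[OF refl], rule sum.cong[OF refl],
        rule sum.cong[OF refl], rule sum.cong[OF refl])
      (metis C_sym[OF p] \<Gamma>_sym[OF p] gu_sym[OF p] mult.commute mult.left_commute)
  have "(\<Sum>j\<in>UNIV. \<Sum>k\<in>UNIV. gu j k p * ds (Rc j k) p) =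
      (\<Sum>j\<in>UNIV. \<Sum>k\<in>UNIV. \<Sum>q\<in>UNIV. gu j k p * dx q (C q j k) p) - (\<Sum>j\<in>UNIV. \<Sum>k\<in>UNIV. \<Sum>q\<in>UNIV. gu j k p * dx j (C q q k) p)
      + (\<Sum>j\<in>UNIV. \<Sum>k\<in>UNIV. \<Sum>q\<in>UNIV. \<Sum>r\<in>UNIV. gu j k p * (C r j k p * \<Gamma> q q r p))
      + (\<Sum>j\<in>UNIV. \<Sum>k\<in>UNIV. \<Sum>q\<in>UNIV. \<Sum>r\<in>UNIV. gu j k p * (\<Gamma> r j k p * C q q r p))
      - (\<Sum>j\<in>UNIV. \<Sum>k\<in>UNIV. \<Sum>q\<in>UNIV. \<Sum>r\<in>UNIV. gu j k p * (C r q k p * \<Gamma> q j r p))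
      - (\<Sum>j\<in>UNIV. \<Sum>k\<in>UNIV. \<Sum>q\<in>UNIV. \<Sum>r\<in>UNIV. gu j k p * (\<Gamma> r q k p * C q j r p))"
    by (simp add: ds_Rc[OF p] sum_distrib_left right_diff_distrib distrib_left sum.distrib sum_subtractf)
  also have "\<dots> = divg Vl p - 1/2 * divg (\<lambda>k. dx k tr) p"
    unfolding T1 T2 T3 T4 T5 T6 divg_Vl[OF p]
    by (simp add: divg_def right_diff_distrib sum_subtractf)
  finally show ?thesis .
qed

text \<open>Besides the traced Ricci variation, the derivative of g^{jk} contributes
  \<open>- Rch p\<close>.\<close>

lemma ds_R:
  assumes p: "p \<in> S"
  shows "ds R p = divg Vl p - 1/2 * divg (\<lambda>k. dx k tr) p - Rch p"
proof -
  have "(\<Sum>i\<in>UNIV. \<Sum>j\<in>UNIV. (\<Sum>k\<in>UNIV. \<Sum>l\<in>UNIV. gu i k p * h k l p * gu l j p) * Rc i j p) = Rch p"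
    by (simp add: Rch_def sum_distrib_right sum_distrib_left gu_sym[OF p] mult_ac)
  moreover have "ds R p = (\<Sum>j\<in>UNIV. \<Sum>k\<in>UNIV. gu j k p * ds (Rc j k) p)
      - (\<Sum>i\<in>UNIV. \<Sum>j\<in>UNIV. (\<Sum>k\<in>UNIV. \<Sum>l\<in>UNIV. gu i k p * h k l p * gu l j p) * Rc i j p)"
    unfolding R_def[abs_def]
    by (simp add: dd_sum dd_mult p dd_gu[OF p] h_def sum.distrib sum_negf sum_subtractf)
  ultimately show ?thesis by (simp add: trace_ds_Rc[OF p])
qed

section \<open>The DeTurck flow at the parameter value zero\<close>

definition "S0 = {p \<in> S. fst (snd p) = 0}"

lemma S0_S: "p \<in> S0 \<Longrightarrow> p \<in> S"
  by (simp add: S0_def)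

text \<open>The direction is tangent to the slice s = 0, so the line through \<open>p\<close> stays
  in it. This covers t- and x-derivatives.\<close>

lemma dd_cong_S0:
  assumes "p \<in> S0" "fst (snd b) = 0" "\<And>q. q \<in> S0 \<Longrightarrow> f q = g q"
  shows "dd S b f p = dd S b g p"
  by (rule dd_cong_line) (use assms in \<open>auto simp: S0_def\<close>)

lemma W_S0: "p \<in> S0 \<Longrightarrow> W k p = 0"
proof -
  assume "p \<in> S0"
  hence "(fst p, 0, snd (snd p)) = p" by (auto simp: S0_def)
  thus ?thesis by (simp add: W_def \<Gamma>\<^sub>0_def)
qed

lemma Wl_S0: "p \<in> S0 \<Longrightarrow> Wl k p = 0"
  by (simp add: Wl_def W_S0)

lemma dd_Wl_S0: "p \<in> S0 \<Longrightarrow> b \<in> Basis \<Longrightarrow> fst (snd b) = 0 \<Longrightarrow> dd S b (Wl k) p = 0"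
  using dd_cong_S0[of p b "Wl k" "\<lambda>_. 0"] by (simp add: Wl_S0 dd_const S0_S)

lemma N_S0: "p \<in> S0 \<Longrightarrow> N p = 0"
  by (simp add: N_def W_S0)

lemma ds_\<Gamma>\<^sub>0: "p \<in> S \<Longrightarrow> ds (\<Gamma>\<^sub>0 k i j) p = 0"
  using dd_cong_line[of p S "(0, 1, 0)" "\<Gamma>\<^sub>0 k i j" "\<lambda>_. \<Gamma>\<^sub>0 k i j p"] dd_const[of p "(0, 1, 0)"]
  by (simp add: \<Gamma>\<^sub>0_def)

text \<open>\<open>\<Gamma>\<^sub>0\<close> does not move with s, and the difference of the two
  connections is zero on the slice, so the derivative of g^{ij} drops out.\<close>

lemma ds_W:
  assumes p: "p \<in> S0"
  shows "ds (W k) p = V k p"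
proof -
  have "(fst p, 0, snd (snd p)) = p" using p by (auto simp: S0_def)
  thus ?thesis
    unfolding W_def[abs_def]
    by (simp add: dd_sum dd_mult dd_diff S0_S[OF p] ds_\<Gamma>\<^sub>0 V_def C_def)
      (simp add: \<Gamma>\<^sub>0_def)
qed

lemma ds_Wl: "p \<in> S0 \<Longrightarrow> ds (Wl k) p = Vl k p"
  unfolding Wl_def[abs_def]
  by (simp add: dd_sum dd_mult S0_S ds_W Vl_def W_S0)

text \<open>\<open>N\<close> is quadratic in W, hence vanishes to second order at s = 0.\<close>

lemma ds_N: "p \<in> S0 \<Longrightarrow> ds N p = 0"
  unfolding N_def[abs_def]
  by (simp add: dd_sum dd_mult S0_S W_S0)

text \<open>Stated for all s and not just on the slice, since it is about to be differentiated in
  s.\<close>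

lemma dt_gl:
  assumes p: "p \<in> S"
  shows "dt (gl i j) p = - 2 * Rc i j p
    + (dx i (Wl j) p - (\<Sum>q\<in>UNIV. \<Gamma> q i j p * Wl q p)) + (dx j (Wl i) p - (\<Sum>q\<in>UNIV. \<Gamma> q j i p * Wl q p))"
proof -
  obtain t s x where pt: "p = (t, s, x)" "t \<in> I" "s \<in> J" "x \<in> U" using p by auto
  have cd: "cd_cov (G t s) (lower (G t s) (deturck (G t s) (G t 0))) i j x
      = dx i (Wl j) p - (\<Sum>q\<in>UNIV. \<Gamma> q i j p * Wl q p)" for i j
    unfolding pt(1)
    by (rule cd_cov_eq[OF pt(2,3) refl pt(4) smooth_Wl]) (rule lower_deturck_eq[OF pt(2,3)]; simp)
  have "at t within I \<noteq> bot" using islimpt_I[OF pt(2)] by (simp add: trivial_limit_within)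
  hence "td I (\<lambda>\<tau> x. G \<tau> s x $ i $ j) t x = - 2 * Rc i j p
    + (dx i (Wl j) p - (\<Sum>q\<in>UNIV. \<Gamma> q i j p * Wl q p)) + (dx j (Wl i) p - (\<Sum>q\<in>UNIV. \<Gamma> q j i p * Wl q p))"
    using flow_G[OF pt(2-4), of i j] cd[of i j] cd[of j i] ricci_eq[OF pt(2,3) refl pt(4), of i j]
    unfolding td_def
    by (intro vector_derivative_within)
      (auto simp: has_real_derivative_iff_has_vector_derivative pt(1) Let_def)
  moreover have "td I (\<lambda>\<tau> x. G \<tau> s x $ i $ j) t x = dt (gl i j) p"
    unfolding pt(1) by (rule td_eq_dt[OF smooth_gl pt(2-4)]) (simp add: gl_def)
  ultimately show ?thesis by simp
qed

lemma dt_h: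
  assumes p: "p \<in> S0"
  shows "dt (h i j) p = - 2 * ds (Rc i j) p
    + (dx i (Vl j) p - (\<Sum>q\<in>UNIV. \<Gamma> q i j p * Vl q p)) + (dx j (Vl i) p - (\<Sum>q\<in>UNIV. \<Gamma> q j i p * Vl q p))"
proof -
  have pS: "p \<in> S" by (rule S0_S[OF p])
  \<comment> \<open>\<open>ds (Wl j)\<close> is known on the slice only; after the exchange it is
    differentiated along the slice.\<close>
  have ds_dx: "ds (dx i (Wl j)) p = dx i (Vl j) p" for i j
    using dd_cong_S0[OF p, of "(0, 0, axis i 1)" "ds (Wl j)" "Vl j"] ds_Wl
    by (simp add: dd_commute[of _ "(0, 1, 0)" "(0, 0, axis _ 1)" p] pS)
  have "dt (h i j) p = ds (dt (gl i j)) p"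
    by (simp add: h_def dd_commute[of _ "(1, 0, 0)" "(0, 1, 0)" p] pS)
  also have "\<dots> = ds (\<lambda>p. - 2 * Rc i j p
    + (dx i (Wl j) p - (\<Sum>q\<in>UNIV. \<Gamma> q i j p * Wl q p)) + (dx j (Wl i) p - (\<Sum>q\<in>UNIV. \<Gamma> q j i p * Wl q p))) p"
    by (rule dd_cong[OF pS dt_gl])
  finally show ?thesis
    by (simp add: dd_add dd_diff dd_minus dd_cmult dd_sum dd_mult pS ds_dx ds_Wl[OF p] Wl_S0[OF p])
qed

text \<open>Each of the two covariant derivatives of V has trace div V; together they cancel the -2
  div V that comes from the Ricci variation.\<close>

lemma trace_dt_h:
  assumes p: "p \<in> S0"
  shows "(\<Sum>i\<in>UNIV. \<Sum>j\<in>UNIV. gu i j p * dt (h i j) p) = divg (\<lambda>k. dx k tr) p"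
proof -
  have pS: "p \<in> S" by (rule S0_S[OF p])
  have "(\<Sum>i\<in>UNIV. \<Sum>j\<in>UNIV. gu i j p * (dx j (Vl i) p - (\<Sum>q\<in>UNIV. \<Gamma> q j i p * Vl q p))) = divg Vl p"
    unfolding divg_def by (subst sum.swap) (simp add: gu_sym[OF pS])
  moreover have "(\<Sum>i\<in>UNIV. \<Sum>j\<in>UNIV. gu i j p * dt (h i j) p) = - 2 * (\<Sum>i\<in>UNIV. \<Sum>j\<in>UNIV. gu i j p * ds (Rc i j) p)
      + divg Vl p + (\<Sum>i\<in>UNIV. \<Sum>j\<in>UNIV. gu i j p * (dx j (Vl i) p - (\<Sum>q\<in>UNIV. \<Gamma> q j i p * Vl q p)))"
    unfolding dt_h[OF p] divg_def sum_distrib_left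
    by (simp only: distrib_left sum.distrib mult.left_commute[of _ "- 2"])
  ultimately show ?thesis by (simp add: trace_ds_Rc[OF pS])
qed

text \<open>On the slice W and its x-derivatives vanish, so g moves by -2 Rc and g^{-1} by 2 Rc with
  raised indices; contraction with h gives \<open>2 * Rch p\<close>.\<close>

lemma dt_tr:
  assumes p: "p \<in> S0"
  shows "dt tr p = 2 * Rch p + divg (\<lambda>k. dx k tr) p"
proof -
  have pS: "p \<in> S" by (rule S0_S[OF p])
  have gu': "dt (gu i j) p = 2 * (\<Sum>k\<in>UNIV. \<Sum>l\<in>UNIV. gu i k p * Rc k l p * gu l j p)" for i j
    by (simp add: dd_gu[OF pS] dt_gl[OF pS] Wl_S0[OF p] dd_Wl_S0[OF p] sum_negf sum_distrib_left mult_ac)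
  have "(\<Sum>i\<in>UNIV. \<Sum>j\<in>UNIV. (\<Sum>k\<in>UNIV. \<Sum>l\<in>UNIV. gu i k p * Rc k l p * gu l j p) * h i j p)
      = (\<Sum>i\<in>UNIV. \<Sum>j\<in>UNIV. \<Sum>k\<in>UNIV. \<Sum>l\<in>UNIV. gu i k p * Rc k l p * gu l j p * h i j p)"
    by (simp add: sum_distrib_right)
  also have "\<dots> = Rch p"
    unfolding Rch_def by (subst sum4_rotate2) (simp add: gu_sym[OF pS] mult_ac)
  finally have 1: "(\<Sum>i\<in>UNIV. \<Sum>j\<in>UNIV. (\<Sum>k\<in>UNIV. \<Sum>l\<in>UNIV. gu i k p * Rc k l p * gu l j p) * h i j p) = Rch p" .
  have "dt tr p = (\<Sum>i\<in>UNIV. \<Sum>j\<in>UNIV. dt (gu i j) p * h i j p) + (\<Sum>i\<in>UNIV. \<Sum>j\<in>UNIV. gu i j p * dt (h i j) p)"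
    unfolding tr_def[abs_def] by (simp add: dd_sum dd_mult pS sum.distrib)
  thus ?thesis
    using 1 by (simp add: gu' trace_dt_h[OF p] mult.assoc sum_distrib_left[symmetric])
qed

text \<open>The Laplacians of the trace add up to -1/2 - 1/2 + 1 = 0, the terms \<open>Rch p\<close>
  to -1 + 2 = 1.\<close>

lemma ds_R_dt_tr:
  assumes p: "p \<in> S0"
  shows "ds R p + dt tr p = divg divh p + Rch p"
  using ds_R[OF S0_S[OF p]] dt_tr[OF p] divg_Vl_eq[OF S0_S[OF p]] by simp

end

section \<open>Variation of the space-time connection\<close>

lemma sum_option: "(\<Sum>a\<in>(UNIV :: 'a::finite option set). f a) = f None + (\<Sum>i\<in>UNIV. f (Some i))"
  by (simp add: UNIV_option_conv sum.reindex)

context metric_family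
begin

text \<open>The components $\tilde\Gamma^k_{i0}$ and $\tilde\Gamma^k_{00}$.\<close>

definition "\<Gamma>\<^sub>t k i p = - (\<Sum>a\<in>UNIV. gu k a p * Rc a i p) + (dx i (W k) p + (\<Sum>r\<in>UNIV. \<Gamma> k i r p * W r p))"
definition "\<Gamma>\<^sub>t\<^sub>t k p = - 1/2 * (\<Sum>l\<in>UNIV. gu k l p * dx l (\<lambda>q. R q + N q) p) + (\<Sum>a\<in>UNIV. gu k a p * dt (Wl a) p)"

lemma smooth_\<Gamma>\<^sub>t [simp]: "smooth_on S (\<Gamma>\<^sub>t k i)"
  unfolding \<Gamma>\<^sub>t_def[abs_def] by simp

lemma smooth_\<Gamma>\<^sub>t\<^sub>t [simp]: "smooth_on S (\<Gamma>\<^sub>t\<^sub>t k)"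
  unfolding \<Gamma>\<^sub>t\<^sub>t_def[abs_def] by simp

lemma dd_W_S0: "p \<in> S0 \<Longrightarrow> b \<in> Basis \<Longrightarrow> fst (snd b) = 0 \<Longrightarrow> dd S b (W k) p = 0"
  using dd_cong_S0[of p b "W k" "\<lambda>_. 0"] by (simp add: W_S0 dd_const S0_S)

lemma dd_N_S0: "p \<in> S0 \<Longrightarrow> b \<in> Basis \<Longrightarrow> fst (snd b) = 0 \<Longrightarrow> dd S b N p = 0"
  using dd_cong_S0[of p b N "\<lambda>_. 0"] by (simp add: N_S0 dd_const S0_S)

lemma \<Gamma>\<^sub>t_S0: "p \<in> S0 \<Longrightarrow> \<Gamma>\<^sub>t k i p = - (\<Sum>a\<in>UNIV. gu k a p * Rc a i p)"
  by (simp add: \<Gamma>\<^sub>t_def dd_W_S0 W_S0)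

lemma \<Gamma>\<^sub>t\<^sub>t_S0: "p \<in> S0 \<Longrightarrow> \<Gamma>\<^sub>t\<^sub>t k p = - 1/2 * (\<Sum>l\<in>UNIV. gu k l p * dx l R p)"
  by (simp add: \<Gamma>\<^sub>t\<^sub>t_def dd_Wl_S0 dd_add dd_N_S0 S0_S)

lemma ds_dd_S0:
  assumes p: "p \<in> S0" and b: "b \<in> Basis" "fst (snd b) = 0" and f: "smooth_on S f"
    and e: "\<And>q. q \<in> S0 \<Longrightarrow> ds f q = f' q"
  shows "ds (dd S b f) p = dd S b f' p"
  using dd_commute[OF f _ b(1) S0_S[OF p], of "(0, 1, 0)"] dd_cong_S0[OF p b(2) e] by simp

lemma ds_gu:
  assumes p: "p \<in> S"
  shows "ds (gu i j) p = - (\<Sum>k\<in>UNIV. \<Sum>l\<in>UNIV. gu i k p * gu j l p * h k l p)"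
  by (simp add: dd_gu[OF p] h_def gu_sym[OF p] mult_ac)

text \<open>For \<open>f\<close> the Ricci components or the differential of R, the inner sum is on
  the slice a multiple of \<open>\<Gamma>\<^sub>t\<close> or
  \<open>\<Gamma>\<^sub>t\<^sub>t\<close>. The variation of g^{ka} thus becomes a connection term of
  a space-time covariant derivative of h.\<close>

lemma ds_gu_contract:
  assumes p: "p \<in> S"
  shows "(\<Sum>a\<in>UNIV. ds (gu k a) p * f a) = - (\<Sum>l\<in>UNIV. gu k l p * (\<Sum>n\<in>UNIV. (\<Sum>a\<in>UNIV. gu n a p * f a) * h n l p))"
proof -
  have "(\<Sum>a\<in>UNIV. ds (gu k a) p * f a) = - (\<Sum>a\<in>UNIV. \<Sum>l\<in>UNIV. \<Sum>n\<in>UNIV. gu k l p * (gu n a p * f a * h n l p))"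
    by (simp add: dd_gu[OF p] h_def[symmetric] h_sym[OF p] sum_distrib_right sum_distrib_left sum_negf mult_ac)
  also have "(\<Sum>a\<in>UNIV. \<Sum>l\<in>UNIV. \<Sum>n\<in>UNIV. gu k l p * (gu n a p * f a * h n l p))
      = (\<Sum>l\<in>UNIV. \<Sum>n\<in>UNIV. \<Sum>a\<in>UNIV. gu k l p * (gu n a p * f a * h n l p))"
    by (rule sum3_rotate)
  also have "\<dots> = (\<Sum>l\<in>UNIV. gu k l p * (\<Sum>n\<in>UNIV. (\<Sum>a\<in>UNIV. gu n a p * f a) * h n l p))"
    by (simp add: sum_distrib_left sum_distrib_right)
  finally show ?thesis .
qed

lemma ds_\<Gamma>:
  assumes p: "p \<in> S"
  shows "ds (\<Gamma> k i j) p = 1/2 * (\<Sum>l\<in>UNIV. gu k l p * (Dh i j l p + Dh j i l p - Dh l i j p))"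
  using C_eq[OF p, of k i j] by (simp add: C_def sum_divide_distrib)

text \<open>The three brackets are the space-time derivatives nabla_i h_{0l}, nabla_0 h_{il} and
  nabla_l h_{i0} written out; the terms with \<open>\<Gamma>\<^sub>t q l p\<close> cancel.
  Eliminating the Ricci variation by \<open>dt_h\<close> leaves the time derivative of h and the
  antisymmetrized derivative of V.\<close>

lemma ds_\<Gamma>\<^sub>t:
  assumes p: "p \<in> S0"
  shows "ds (\<Gamma>\<^sub>t k i) p = 1/2 * (\<Sum>l\<in>UNIV. gu k l p *
     ((dx i (divh l) p - (\<Sum>q\<in>UNIV. \<Gamma>\<^sub>t q i p * h q l p) - (\<Sum>q\<in>UNIV. \<Gamma> q i l p * divh q p))
      + (dt (h i l) p - (\<Sum>q\<in>UNIV. \<Gamma>\<^sub>t q i p * h q l p) - (\<Sum>q\<in>UNIV. \<Gamma>\<^sub>t q l p * h i q p))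
      - (dx l (divh i) p - (\<Sum>q\<in>UNIV. \<Gamma> q l i p * divh q p) - (\<Sum>q\<in>UNIV. \<Gamma>\<^sub>t q l p * h i q p))))"
proof -
  have pS: "p \<in> S" by (rule S0_S[OF p])
  have dV: "dx i (Vl l) p = dx i (divh l) p - 1/2 * dx i (dx l tr) p" for i l
  proof -
    have "dx i (Vl l) p = dx i (\<lambda>q. divh l q - 1/2 * dx l tr q) p"
      by (rule dd_cong[OF pS Vl_eq])
    thus ?thesis by (simp add: dd_diff dd_divide pS)
  qed
  have "ds (\<Gamma>\<^sub>t k i) p = - (\<Sum>a\<in>UNIV. ds (gu k a) p * Rc a i p) - (\<Sum>l\<in>UNIV. gu k l p * ds (Rc l i) p)
      + (dx i (V k) p + (\<Sum>r\<in>UNIV. \<Gamma> k i r p * V r p))"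
    unfolding \<Gamma>\<^sub>t_def[abs_def]
    by (simp add: dd_add dd_diff dd_minus dd_sum dd_mult pS ds_dd_S0[OF p _ _ _ ds_W] ds_W[OF p] W_S0[OF p]
        sum.distrib)
  also have "- (\<Sum>a\<in>UNIV. ds (gu k a) p * Rc a i p) = - (\<Sum>l\<in>UNIV. gu k l p * (\<Sum>q\<in>UNIV. \<Gamma>\<^sub>t q i p * h q l p))"
    by (simp add: ds_gu_contract[OF pS] \<Gamma>\<^sub>t_S0[OF p] sum_negf)
  also have "dx i (V k) p + (\<Sum>r\<in>UNIV. \<Gamma> k i r p * V r p)
      = (\<Sum>l\<in>UNIV. gu k l p * (dx i (Vl l) p - (\<Sum>q\<in>UNIV. \<Gamma> q i l p * Vl q p)))"
    by (rule raise_cd_Vl[OF pS, symmetric])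
  finally have "ds (\<Gamma>\<^sub>t k i) p = (\<Sum>l\<in>UNIV. gu k l p * (- (\<Sum>q\<in>UNIV. \<Gamma>\<^sub>t q i p * h q l p) - ds (Rc l i) p
      + (dx i (Vl l) p - (\<Sum>q\<in>UNIV. \<Gamma> q i l p * Vl q p))))"
    by (simp add: distrib_left right_diff_distrib sum.distrib sum_subtractf sum_negf)
  also have "\<dots> = (\<Sum>l\<in>UNIV. gu k l p * (1/2 *
     ((dx i (divh l) p - (\<Sum>q\<in>UNIV. \<Gamma>\<^sub>t q i p * h q l p) - (\<Sum>q\<in>UNIV. \<Gamma> q i l p * divh q p))
      + (dt (h i l) p - (\<Sum>q\<in>UNIV. \<Gamma>\<^sub>t q i p * h q l p) - (\<Sum>q\<in>UNIV. \<Gamma>\<^sub>t q l p * h i q p))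
      - (dx l (divh i) p - (\<Sum>q\<in>UNIV. \<Gamma> q l i p * divh q p) - (\<Sum>q\<in>UNIV. \<Gamma>\<^sub>t q l p * h i q p)))))"
  proof (intro sum.cong refl arg_cong[of _ _ "(*) _"])
    fix l
    have "dt (h i l) p = - 2 * ds (Rc l i) p
      + (dx l (Vl i) p - (\<Sum>q\<in>UNIV. \<Gamma> q l i p * Vl q p)) + (dx i (Vl l) p - (\<Sum>q\<in>UNIV. \<Gamma> q i l p * Vl q p))"
      using dt_h[OF p, of l i] dd_h_sym[OF pS, of _ i l] by simp
    moreover have "(\<Sum>q\<in>UNIV. \<Gamma> q l i p * Vl q p) = (\<Sum>q\<in>UNIV. \<Gamma> q i l p * Vl q p)"
      "(\<Sum>q\<in>UNIV. \<Gamma> q l i p * divh q p) = (\<Sum>q\<in>UNIV. \<Gamma> q i l p * divh q p)"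
      by (simp_all add: \<Gamma>_sym[OF pS, of _ l i])
    \<comment> \<open>Therefore the antisymmetrized derivative of V is that of div(h).\<close>
    moreover have "dx i (dx l tr) p = dx l (dx i tr) p"
      by (rule dd_commute) (simp_all add: pS)
    ultimately show "- (\<Sum>q\<in>UNIV. \<Gamma>\<^sub>t q i p * h q l p) - ds (Rc l i) p
      + (dx i (Vl l) p - (\<Sum>q\<in>UNIV. \<Gamma> q i l p * Vl q p)) = 1/2 *
     ((dx i (divh l) p - (\<Sum>q\<in>UNIV. \<Gamma>\<^sub>t q i p * h q l p) - (\<Sum>q\<in>UNIV. \<Gamma> q i l p * divh q p))
      + (dt (h i l) p - (\<Sum>q\<in>UNIV. \<Gamma>\<^sub>t q i p * h q l p) - (\<Sum>q\<in>UNIV. \<Gamma>\<^sub>t q l p * h i q p))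
      - (dx l (divh i) p - (\<Sum>q\<in>UNIV. \<Gamma> q l i p * divh q p) - (\<Sum>q\<in>UNIV. \<Gamma>\<^sub>t q l p * h i q p)))"
      using dV[of i l] dV[of l i] by argo
  qed
  finally show ?thesis by (simp add: sum_divide_distrib)
qed

text \<open>The right-hand side is 2 nabla_0 h_{0l} - nabla_l h_{00} written out; its terms with
  \<open>divh q p\<close> cancel. On the left, the time derivative of V_l contributes that of
  div(h)_l and -1/2 d_l d_t tr h, and the latter combines with the variation of -1/2 d_l R.\<close>

lemma ds_\<Gamma>\<^sub>t\<^sub>t:
  assumes p: "p \<in> S0"
  shows "ds (\<Gamma>\<^sub>t\<^sub>t k) p = 1/2 * (\<Sum>l\<in>UNIV. gu k l p *
     (2 * (dt (divh l) p - (\<Sum>q\<in>UNIV. \<Gamma>\<^sub>t\<^sub>t q p * h q l p) - (\<Sum>q\<in>UNIV. \<Gamma>\<^sub>t q l p * divh q p))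
      - (dx l (\<lambda>q. divg divh q + Rch q) p - (\<Sum>q\<in>UNIV. \<Gamma>\<^sub>t q l p * divh q p) - (\<Sum>q\<in>UNIV. \<Gamma>\<^sub>t q l p * divh q p))))"
proof -
  have pS: "p \<in> S" by (rule S0_S[OF p])
  have sd: "smooth_on S (divg divh)" by (rule smooth_divg) simp
  have dV: "dt (Vl l) p = dt (divh l) p - 1/2 * dx l (dt tr) p" for l
  proof -
    have "dt (Vl l) p = dt (\<lambda>q. divh l q - 1/2 * dx l tr q) p"
      by (rule dd_cong[OF pS Vl_eq])
    thus ?thesis
      by (simp add: dd_diff dd_divide pS dd_commute[of _ "(1, 0, 0)" "(0, 0, axis _ 1)" p])
  qed
  \<comment> \<open>\<open>ds_R_dt_tr\<close> holds on the slice only, which suffices for an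
    x-derivative.\<close>
  have dR: "dx l (ds R) p + dx l (dt tr) p = dx l (\<lambda>q. divg divh q + Rch q) p" for l
  proof -
    have "dx l (\<lambda>q. ds R q + dt tr q) p = dx l (\<lambda>q. divg divh q + Rch q) p"
      by (rule dd_cong_S0[OF p _ ds_R_dt_tr]) simp
    thus ?thesis by (simp add: dd_add pS)
  qed
  have dN: "ds (dx l (\<lambda>q. R q + N q)) p = dx l (ds R) p" for l
    by (rule ds_dd_S0[OF p]) (simp_all add: dd_add S0_S ds_N)
  \<comment> \<open>On the slice \<open>\<Gamma>\<^sub>t\<^sub>t\<close> is -1/2 times the gradient
    of R; these identities carry the constant through the sums.\<close>
  have half: "(\<Sum>q\<in>UNIV. - 1/2 * X q * h q l p) = - 1/2 * (\<Sum>q\<in>UNIV. X q * h q l p)" 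
    and half': "(\<Sum>q\<in>UNIV. gu k q p * (- 1/2 * X q)) = - 1/2 * (\<Sum>q\<in>UNIV. gu k q p * X q)" for X :: "'n \<Rightarrow> real" and l
    by (simp_all add: sum_negf sum_divide_distrib)
  have "ds (\<Gamma>\<^sub>t\<^sub>t k) p = - 1/2 * (\<Sum>l\<in>UNIV. ds (gu k l) p * dx l R p) - 1/2 * (\<Sum>l\<in>UNIV. gu k l p * dx l (ds R) p)
      + (\<Sum>l\<in>UNIV. gu k l p * dt (Vl l) p)"
    unfolding \<Gamma>\<^sub>t\<^sub>t_def[abs_def]
    by (simp add: dd_add dd_diff dd_minus dd_divide dd_sum dd_mult pS dN ds_dd_S0[OF p _ _ _ ds_Wl] dd_Wl_S0[OF p]
        dd_N_S0[OF p] sum.distrib add_divide_distrib)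
  also have "- 1/2 * (\<Sum>l\<in>UNIV. ds (gu k l) p * dx l R p) = - (\<Sum>l\<in>UNIV. gu k l p * (\<Sum>q\<in>UNIV. \<Gamma>\<^sub>t\<^sub>t q p * h q l p))"
    unfolding ds_gu_contract[OF pS] \<Gamma>\<^sub>t\<^sub>t_S0[OF p] half half' by simp
  finally have "ds (\<Gamma>\<^sub>t\<^sub>t k) p = (\<Sum>l\<in>UNIV. gu k l p * (- (\<Sum>q\<in>UNIV. \<Gamma>\<^sub>t\<^sub>t q p * h q l p) - 1/2 * dx l (ds R) p
      + dt (Vl l) p))"
    by (simp add: distrib_left right_diff_distrib sum.distrib sum_subtractf sum_negf sum_divide_distrib)
  also have "\<dots> = (\<Sum>l\<in>UNIV. gu k l p * (1/2 *
     (2 * (dt (divh l) p - (\<Sum>q\<in>UNIV. \<Gamma>\<^sub>t\<^sub>t q p * h q l p) - (\<Sum>q\<in>UNIV. \<Gamma>\<^sub>t q l p * divh q p))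
      - (dx l (\<lambda>q. divg divh q + Rch q) p - (\<Sum>q\<in>UNIV. \<Gamma>\<^sub>t q l p * divh q p) - (\<Sum>q\<in>UNIV. \<Gamma>\<^sub>t q l p * divh q p)))))"
    using dV dR by (intro sum.cong refl arg_cong[of _ _ "(*) _"]) (simp add: dR[symmetric])
  finally show ?thesis by (simp add: sum_divide_distrib)
qed

text \<open>\<open>m\<close> and \<open>H\<close> stand for the given g(t) and h(t), which are tied
  to \<open>G\<close> on the chart only. The hypotheses range over all times because the extension
  of h is also differentiated in time.\<close>

context
  fixes m H :: "real \<Rightarrow> real^'n \<Rightarrow> real^'n^'n" and hst and D and t x
  assumes m: "\<And>\<tau> y. \<tau> \<in> I \<Longrightarrow> y \<in> U \<Longrightarrow> m \<tau> y = G \<tau> 0 y"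
    and H: "\<And>\<tau> y i j. \<tau> \<in> I \<Longrightarrow> y \<in> U \<Longrightarrow>
      ((\<lambda>s. G \<tau> s y $ i $ j) has_real_derivative H \<tau> y $ i $ j) (at 0)"
    and t: "t \<in> I" and x: "x \<in> U"
  defines "hst \<equiv> (\<lambda>i j \<tau>. st_extension (m \<tau>) (H \<tau>) i j)"
    and "D \<equiv> st_cd I (st_christoffel I (\<lambda>\<tau>. G \<tau> 0) (\<lambda>\<tau>. G \<tau> 0)) hst"
begin

lemma H_eq: "\<tau> \<in> I \<Longrightarrow> y \<in> U \<Longrightarrow> H \<tau> y $ i $ j = h i j (\<tau>, 0, y)"
  using has_real_derivative_ds[OF smooth_gl _ zero_J, of \<tau> y "\<lambda>s. G \<tau> s y $ i $ j" i j]
  by (intro DERIV_unique[OF H]) (auto simp: h_def gl_def)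

lemma hst_eq:
  assumes "\<tau> \<in> I" "y \<in> U"
  shows "hst (Some i) (Some j) \<tau> y = h i j (\<tau>, 0, y)"
    and "hst None (Some j) \<tau> y = divh j (\<tau>, 0, y)"
    and "hst (Some j) None \<tau> y = divh j (\<tau>, 0, y)"
    and "hst None None \<tau> y = divg divh (\<tau>, 0, y) + Rch (\<tau>, 0, y)"
  using div2_eq[OF assms(1) zero_J m H_eq, of y j] ricci_dot_eq[OF assms(1) zero_J m H_eq, of y]
    div1_div2_eq[OF assms(1) zero_J m H_eq, of y] assms
  by (simp_all add: hst_def H_eq)

lemma st_christoffel_eq:
  assumes s: "s \<in> J"
  defines "\<Gamma>st \<equiv> st_christoffel I (\<lambda>\<tau>. G \<tau> s) (\<lambda>\<tau>. G \<tau> 0)"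
  shows "\<Gamma>st None a b t x = 0"
    and "\<Gamma>st (Some k) (Some i) (Some j) t x = \<Gamma> k i j (t, s, x)"
    and "\<Gamma>st (Some k) (Some i) None t x = \<Gamma>\<^sub>t k i (t, s, x)"
    and "\<Gamma>st (Some k) None (Some i) t x = \<Gamma>\<^sub>t k i (t, s, x)"
    and "\<Gamma>st (Some k) None None t x = \<Gamma>\<^sub>t\<^sub>t k (t, s, x)"
proof -
  have c: "cd_vec (G t s) (deturck (G t s) (G t 0)) i k x
      = dx i (W k) (t, s, x) + (\<Sum>q\<in>UNIV. \<Gamma> k i q (t, s, x) * W q (t, s, x))" for i k
    by (rule cd_vec_eq[OF t s refl x smooth_W]) (rule deturck_eq[OF t s]; simp)
  have g: "grad (G t s) (\<lambda>y. scal (G t s) y + norm_sq (G t s) (deturck (G t s) (G t 0)) y) k x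
      = (\<Sum>l\<in>UNIV. gu k l (t, s, x) * dx l (\<lambda>q. R q + N q) (t, s, x))" for k
    by (rule grad_eq[OF t s refl x]) (simp_all add: scal_eq[OF t s] norm_sq_deturck_eq[OF t s])
  have w: "td I (\<lambda>\<tau>. lower (G \<tau> s) (deturck (G \<tau> s) (G \<tau> 0)) a) t x = dt (Wl a) (t, s, x)" for a
    by (rule td_eq_dt[OF smooth_Wl t s x]) (rule lower_deturck_eq[OF _ s refl x]; simp)
  show "\<Gamma>st None a b t x = 0"
    and "\<Gamma>st (Some k) (Some i) (Some j) t x = \<Gamma> k i j (t, s, x)"
    and "\<Gamma>st (Some k) (Some i) None t x = \<Gamma>\<^sub>t k i (t, s, x)"
    and "\<Gamma>st (Some k) None (Some i) t x = \<Gamma>\<^sub>t k i (t, s, x)"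
    and "\<Gamma>st (Some k) None None t x = \<Gamma>\<^sub>t\<^sub>t k (t, s, x)"
    unfolding \<Gamma>st_def
    by (simp_all add: christoffel_eq[OF t s refl x] ricci_up_eq[OF t s refl x] c g w ginv_eq[OF t s refl x]
        \<Gamma>\<^sub>t_def \<Gamma>\<^sub>t\<^sub>t_def)
qed

lemma st_pd_hst:
  "st_pd I (Some a) (hst (Some i) (Some j)) t x = dx a (h i j) (t, 0, x)"
  "st_pd I (Some a) (hst (Some i) None) t x = dx a (divh i) (t, 0, x)"
  "st_pd I (Some a) (hst None (Some i)) t x = dx a (divh i) (t, 0, x)"
  "st_pd I (Some a) (hst None None) t x = dx a (\<lambda>q. divg divh q + Rch q) (t, 0, x)"
  "st_pd I None (hst (Some i) (Some j)) t x = dt (h i j) (t, 0, x)"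
  "st_pd I None (hst None (Some i)) t x = dt (divh i) (t, 0, x)"
  unfolding st_pd.simps
  by (intro pd_eq_dx[OF _ t zero_J x] td_eq_dt[OF _ t zero_J x]; simp add: hst_eq t x smooth_divg)+

text \<open>The time summand of each contraction vanishes with the coefficients \<Gamma>^0. These
  components suffice, since \<open>st_metric\<close> forces the last contracted index of the
  connection formula to be spatial.\<close>

lemma D_eq:
  "D (Some i) (Some j) (Some l) t x = Dh i j l (t, 0, x)"
  "D (Some i) None (Some l) t x = dx i (divh l) (t, 0, x)
     - (\<Sum>q\<in>UNIV. \<Gamma>\<^sub>t q i (t, 0, x) * h q l (t, 0, x)) - (\<Sum>q\<in>UNIV. \<Gamma> q i l (t, 0, x) * divh q (t, 0, x))"
  "D None (Some i) (Some l) t x = dt (h i l) (t, 0, x)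
     - (\<Sum>q\<in>UNIV. \<Gamma>\<^sub>t q i (t, 0, x) * h q l (t, 0, x)) - (\<Sum>q\<in>UNIV. \<Gamma>\<^sub>t q l (t, 0, x) * h i q (t, 0, x))"
  "D (Some l) (Some i) None t x = dx l (divh i) (t, 0, x)
     - (\<Sum>q\<in>UNIV. \<Gamma> q l i (t, 0, x) * divh q (t, 0, x)) - (\<Sum>q\<in>UNIV. \<Gamma>\<^sub>t q l (t, 0, x) * h i q (t, 0, x))"
  "D None None (Some l) t x = dt (divh l) (t, 0, x)
     - (\<Sum>q\<in>UNIV. \<Gamma>\<^sub>t\<^sub>t q (t, 0, x) * h q l (t, 0, x)) - (\<Sum>q\<in>UNIV. \<Gamma>\<^sub>t q l (t, 0, x) * divh q (t, 0, x))"
  "D (Some l) None None t x = dx l (\<lambda>q. divg divh q + Rch q) (t, 0, x)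
     - (\<Sum>q\<in>UNIV. \<Gamma>\<^sub>t q l (t, 0, x) * divh q (t, 0, x)) - (\<Sum>q\<in>UNIV. \<Gamma>\<^sub>t q l (t, 0, x) * divh q (t, 0, x))"
  unfolding D_def st_cd_def sum_option
  by (simp_all add: st_pd_hst st_christoffel_eq[OF zero_J] hst_eq t x Dh_def del: st_christoffel.simps st_pd.simps)

lemma has_real_derivative_st_metric:
  "((\<lambda>s. st_metric (G t s) a b x) has_real_derivative
     - (\<Sum>k\<in>UNIV. \<Sum>l\<in>UNIV. st_metric (G t 0) a k x * st_metric (G t 0) b l x * hst k l t x)) (at 0)"
proof (cases "a = None \<or> b = None")
  case True
  thus ?thesis by (cases a) auto
next
  case False
  then obtain i j where ab: "a = Some i" "b = Some j" by auto
  have "((\<lambda>s. st_metric (G t s) a b x) has_real_derivative ds (gu i j) (t, 0, x)) (at 0)"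
    by (rule has_real_derivative_ds[OF smooth_gu t zero_J x]) (simp add: ab gu_def)
  moreover have "(t, 0, x) \<in> S" using t x zero_J by simp
  ultimately show ?thesis
    by (simp add: ds_gu sum_option ab ginv_eq[OF t zero_J refl x] hst_eq t x)
qed

lemma has_real_derivative_st_christoffel:
  "((\<lambda>s. st_christoffel I (\<lambda>\<tau>. G \<tau> s) (\<lambda>\<tau>. G \<tau> 0) c a b t x) has_real_derivative
     1/2 * (\<Sum>l\<in>UNIV. st_metric (G t 0) c l x * (D a b l t x + D b a l t x - D l a b t x))) (at 0)"
proof (cases c)
  case None
  thus ?thesis by simp
next
  case (Some k)
  have p: "(t, 0, x) \<in> S" "(t, 0, x) \<in> S0" using t x zero_J by (simp_all add: S0_def)
  note eqs = sum_option Some ginv_eq[OF t zero_J refl x] D_eq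
  note deriv = has_real_derivative_ds[OF _ t zero_J x]
  have G: "((\<lambda>s. st_christoffel I (\<lambda>\<tau>. G \<tau> s) (\<lambda>\<tau>. G \<tau> 0) c a b t x) has_real_derivative ds f (t, 0, x)) (at 0)"
    if "smooth_on S f" "\<And>s. s \<in> J \<Longrightarrow> st_christoffel I (\<lambda>\<tau>. G \<tau> s) (\<lambda>\<tau>. G \<tau> 0) c a b t x = f (t, s, x)" for f
    using that by (rule deriv)
  show ?thesis
  proof (cases a; cases b)
    assume ab: "a = None" "b = None"
    show ?thesis
      using G[of "\<Gamma>\<^sub>t\<^sub>t k"] by (simp add: ab eqs st_christoffel_eq ds_\<Gamma>\<^sub>t\<^sub>t[OF p(2)] del: st_christoffel.simps)
  next
    \<comment> \<open>The mirror image of the next case. Here the subtracted covariant derivative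
      has its time index in the middle, which swaps the indices of h relative to
      \<open>ds_\<Gamma>\<^sub>t\<close>.\<close>
    fix j assume ab: "a = None" "b = Some j"
    show ?thesis
      using G[of "\<Gamma>\<^sub>t k j"] by (simp add: ab eqs st_christoffel_eq ds_\<Gamma>\<^sub>t[OF p(2)] h_sym[OF p(1), of _ j] algebra_simps del: st_christoffel.simps)
  next
    fix i assume ab: "a = Some i" "b = None"
    show ?thesis
      using G[of "\<Gamma>\<^sub>t k i"] by (simp add: ab eqs st_christoffel_eq ds_\<Gamma>\<^sub>t[OF p(2)] del: st_christoffel.simps)
  next
    fix i j assume ab: "a = Some i" "b = Some j"
    show ?thesis
      using G[of "\<Gamma> k i j"] by (simp add: ab eqs st_christoffel_eq ds_\<Gamma>[OF p(1)] del: st_christoffel.simps)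
  qed
qed

end

end

section \<open>From the manifold to a single chart\<close>

lemma islimpt_time_interval:
  assumes "t \<in> time_interval T"
  shows "t islimpt time_interval T"
proof -
  \<comment> \<open>A real \<open>b\<close> is taken below \<open>T\<close> because \<open>T\<close>
    may be infinite. Points to the right of t suffice, also at t = 0.\<close>
  obtain b where b: "ereal t < ereal b" "ereal b < T"
    using assms ereal_dense2[of "ereal t" T] by (auto simp: time_interval_def)
  have "{t<..<b} \<subseteq> time_interval T"
    using assms b by (auto simp: time_interval_def intro: less_trans[of _ "ereal b"])
  moreover have "t islimpt {t<..<b}" using b by (intro islimpt_greaterThanLessThan1) simp
  ultimately show ?thesis by (metis islimpt_subset)
qed

lemma invertible_pos_def:
  fixes A :: "real^'n^'n"
  assumes "\<And>v. v \<noteq> 0 \<Longrightarrow> v \<bullet> (A *v v) > 0"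
  shows "invertible A"
proof -
  have "v = 0" if "A *v v = 0" for v using assms[of v] that by force
  thus ?thesis
    by (simp add: invertible_left_inverse matrix_left_invertible_ker)
qed

theorem theorem4p2:
  fixes M :: "'m topology"
    and A :: "('m, 'n::finite) chart set"
    and T :: ereal
    and \<epsilon> :: real
    and g0 h0 :: "('m, 'n) tensor2"
    and g h :: "real \<Rightarrow> ('m, 'n) tensor2"
    and G :: "real \<Rightarrow> real \<Rightarrow> ('m, 'n) tensor2"
  assumes "smooth_manifold M A"
    and "0 < T" and "0 < \<epsilon>"
    and "riemannian_metric A g0" and "sym_tensor_field A h0"
    and "ricci_flow A (time_interval T) g" and "tensor_eq A (g 0) g0"
    and "linearized_flow A (time_interval T) g h" and "tensor_eq A (h 0) h0"
    and "modified_ricci_flow_family A (time_interval T) {-\<epsilon><..<\<epsilon>} G"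
    and "tensor_eq A (G 0 0) g0"
    and "\<forall>c\<in>A. \<forall>x\<in>coords c. \<forall>i j.
           ((\<lambda>s. G 0 s c x $ i $ j) has_real_derivative h0 c x $ i $ j) (at 0)"
    and "\<forall>t\<in>time_interval T. tensor_eq A (G t 0) (g t)"
    and "\<forall>t\<in>time_interval T. \<forall>c\<in>A. \<forall>x\<in>coords c. \<forall>i j.
           ((\<lambda>s. G t s c x $ i $ j) has_real_derivative h t c x $ i $ j) (at 0)"
  shows "\<forall>c\<in>A. \<forall>x\<in>coords c. \<forall>t\<in>time_interval T.
    (let gst = st_metric (G t 0 c);
         hst = (\<lambda>i j \<tau>. st_extension (g \<tau> c) (h \<tau> c) i j);
         \<Gamma>st = (\<lambda>s. st_christoffel (time_interval T) (\<lambda>\<tau>. G \<tau> s c) (\<lambda>\<tau>. G \<tau> 0 c));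
         D = st_cd (time_interval T) (\<Gamma>st 0) hst
     in (\<forall>i j.
           ((\<lambda>s. st_metric (G t s c) i j x) has_real_derivative
              - (\<Sum>k\<in>UNIV. \<Sum>l\<in>UNIV. gst i k x * gst j l x * hst k l t x)) (at 0)) \<and>
        (\<forall>i j k.
           ((\<lambda>s. \<Gamma>st s k i j t x) has_real_derivative
              1/2 * (\<Sum>l\<in>UNIV. gst k l x * (D i j l t x + D j i l t x - D l i j t x))) (at 0)))"
proof (intro ballI)
  fix c x t
  assume c: "c \<in> A" and x: "x \<in> coords c" and t: "t \<in> time_interval T"
  have metric: "riemannian_metric A (G \<tau> s)" if "\<tau> \<in> time_interval T" "s \<in> {-\<epsilon><..<\<epsilon>}" for \<tau> s
    using assms(10) that by (simp add: modified_ricci_flow_family_def)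
  interpret metric_family "time_interval T" "{-\<epsilon><..<\<epsilon>}" "coords c" "\<lambda>t s. G t s c"
  proof
    show "\<tau> islimpt time_interval T" if "\<tau> \<in> time_interval T" for \<tau>
      using that by (rule islimpt_time_interval)
    show "open (coords c)"
      using assms(1) c by (simp add: smooth_manifold_def)
    show "smooth_on (time_interval T \<times> {-\<epsilon><..<\<epsilon>} \<times> coords c) (\<lambda>(t, s, x). G t s c x)"
      using assms(10) c by (simp add: modified_ricci_flow_family_def)
    fix \<tau> s y i j
    assume p: "\<tau> \<in> time_interval T" "s \<in> {-\<epsilon><..<\<epsilon>}" "y \<in> coords c"
    show "transpose (G \<tau> s c y) = G \<tau> s c y"
      using metric[OF p(1,2)] c p(3) by (simp add: riemannian_metric_def sym_tensor_field_def)
    show "invertible (G \<tau> s c y)"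
      using metric[OF p(1,2)] c p(3) by (intro invertible_pos_def) (simp add: riemannian_metric_def)
    show "((\<lambda>\<tau>. G \<tau> s c y $ i $ j) has_real_derivative
         (let W = lower (G \<tau> s c) (deturck (G \<tau> s c) (G \<tau> 0 c)) in
          - 2 * ricci (G \<tau> s c) i j y + cd_cov (G \<tau> s c) W i j y + cd_cov (G \<tau> s c) W j i y))
        (at \<tau> within time_interval T)"
      using assms(10) c p unfolding modified_ricci_flow_family_def by blast
  qed (use assms(3) in auto)
  have g: "g \<tau> c y = G \<tau> 0 c y" if "\<tau> \<in> time_interval T" "y \<in> coords c" for \<tau> y
    using assms(13) c that by (simp add: tensor_eq_def)
  have h: "((\<lambda>s. G \<tau> s c y $ i $ j) has_real_derivative h \<tau> c y $ i $ j) (at 0)"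
    if "\<tau> \<in> time_interval T" "y \<in> coords c" for \<tau> y i j
    using assms(14) c that by blast
  note * = has_real_derivative_st_metric[of "\<lambda>\<tau>. g \<tau> c" "\<lambda>\<tau>. h \<tau> c", OF g h t x]
    has_real_derivative_st_christoffel[of "\<lambda>\<tau>. g \<tau> c" "\<lambda>\<tau>. h \<tau> c", OF g h t x]
  show "let gst = st_metric (G t 0 c);
         hst = (\<lambda>i j \<tau>. st_extension (g \<tau> c) (h \<tau> c) i j);
         \<Gamma>st = (\<lambda>s. st_christoffel (time_interval T) (\<lambda>\<tau>. G \<tau> s c) (\<lambda>\<tau>. G \<tau> 0 c));
         D = st_cd (time_interval T) (\<Gamma>st 0) hst
     in (\<forall>i j.
           ((\<lambda>s. st_metric (G t s c) i j x) has_real_derivative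
              - (\<Sum>k\<in>UNIV. \<Sum>l\<in>UNIV. gst i k x * gst j l x * hst k l t x)) (at 0)) \<and>
        (\<forall>i j k.
           ((\<lambda>s. \<Gamma>st s k i j t x) has_real_derivative
              1/2 * (\<Sum>l\<in>UNIV. gst k l x * (D i j l t x + D j i l t x - D l i j t x))) (at 0))"
    unfolding Let_def by (intro conjI allI *)
qed

end
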